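(* Let $\mathcal Y$ be a finite set of colours and let $B,C\in\mathcal D_s(\mathcal Y)$ be strutless and primitive. Then $$\partial_{\exp B}(\exp C)=\exp\big(\partial_{\exp B}(\exp C)_c\big)$$ in $\mathcal D(\mathcal Y)$.
   Context: A $\mathcal Y$-coloured uni-trivalent graph is a finite undirected graph (loops and multiple edges allowed) each of whose vertices is either trivalent, and equipped with a cyclic ordering of its incident half-edges, or univalent, and assigned a colour in $\mathcal Y$. Graphs are taken up to isomorphism preserving cyclic orderings and colours. $\mathcal D(\mathcal Y)$ is the algebra of formal (possibly infinite) $\mathbb Q$-linear combinations of $\mathcal Y$-coloured uni-trivalent graphs. The product is disjoint union and the unit $1$ is the empty graph. An element is primitive if it is a formal $\mathbb Q$-linear combination of (non-empty) connected graphs. $\exp$ is the usual exponential power series for the disjoint union product. A strut is the graph consisting of a single edge with two univalent vertices. $\mathcal D_s(\mathcal Y)\subset\mathcal D(\mathcal Y)$ is the subalgebra of series in whose graphs no component is a strut having the same colour at both of its vertices. A series is strutless if no component of any of its graphs is a strut. For graphs $g,h$, the diagrammatic differential operator $\partial_g(h)\in\mathcal D(\mathcal Y)$ is the sum of all ways of gluing all of the univalent vertices of $g$ to (some of the) univalent vertices of $h$ of the same colour. That is, one sums over all colour-preserving injections from the set of univalent vertices of $g$ into the set of univalent vertices of $h$, univalent vertices being regarded as distinguishable. Each identified vertex is suppressed, so that the two edges meeting there become a single edge, and the unmatched univalent vertices of $h$ remain as coloured univalent vertices. The sum is $0$ if no such injection exists, and $\partial_1(h)=h$. This is extended bilinearly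 to series. $\partial_{D_1}(D_2)_c$ denotes the primitive part of $\partial_{D_1}(D_2)$, i.e. the sum of those of its terms that are multiples of (non-empty) connected graphs. *)

theory Defs
  imports "HOL.Rat" "HOL-Library.FuncSet" "HOL-Library.Groups_Big_Fun"
    "HOL-Library.While_Combinator"
begin

(* A graph is given by its half-edges. The edges are the orbits {h, mate h} of a fixed-point-free
   involution. The vertices are the orbits of nxt, which satisfies nxt (nxt (nxt h)) = h: an orbit
   of size 3 is a trivalent vertex with its cyclic ordering, a fixed point is a univalent vertex,
   identified with its only half-edge. The values of colour matter at univalent vertices only. *)

record ('h, 'y) ut_pregraph =
  hedges :: "'h set"
  mate :: "'h \<Rightarrow> 'h"
  nxt :: "'h \<Rightarrow> 'h"
  colour :: "'h \<Rightarrow> 'y"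

definition ut_graph :: "('h, 'y) ut_pregraph \<Rightarrow> bool" where
  "ut_graph G \<longleftrightarrow> finite (hedges G) \<and>
     (\<forall>h\<in>hedges G. mate G h \<in> hedges G \<and> mate G h \<noteq> h \<and> mate G (mate G h) = h) \<and>
     (\<forall>h\<in>hedges G. nxt G h \<in> hedges G \<and> nxt G (nxt G (nxt G h)) = h)"

definition univalent :: "('h, 'y) ut_pregraph \<Rightarrow> 'h set" where
  "univalent G = {h \<in> hedges G. nxt G h = h}"

definition ut_iso :: "('h, 'y) ut_pregraph \<Rightarrow> ('k, 'y) ut_pregraph \<Rightarrow> bool" where
  "ut_iso G K \<longleftrightarrow> ut_graph G \<and> ut_graph K \<and>
     (\<exists>\<phi>. bij_betw \<phi> (hedges G) (hedges K) \<and>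
        (\<forall>h\<in>hedges G. \<phi> (mate G h) = mate K (\<phi> h) \<and> \<phi> (nxt G h) = nxt K (\<phi> h)) \<and>
        (\<forall>h\<in>univalent G. colour K (\<phi> h) = colour G h))"

lemma ut_iso_refl: "ut_graph G \<Longrightarrow> ut_iso G G"
  unfolding ut_iso_def by (auto intro!: exI[of _ id])

lemma ut_iso_sym:
  assumes "ut_iso G K"
  shows "ut_iso K G"
proof -
  obtain \<phi> where G: "ut_graph G" and K: "ut_graph K"
    and bij: "bij_betw \<phi> (hedges G) (hedges K)"
    and comm: "\<And>h. h \<in> hedges G \<Longrightarrow> \<phi> (mate G h) = mate K (\<phi> h) \<and> \<phi> (nxt G h) = nxt K (\<phi> h)"
    and col: "\<And>h. h \<in> univalent G \<Longrightarrow> colour K (\<phi> h) = colour G h"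
    using assms unfolding ut_iso_def by blast
  define \<psi> where "\<psi> = inv_into (hedges G) \<phi>"
  have \<psi>: "bij_betw \<psi> (hedges K) (hedges G)"
    unfolding \<psi>_def using bij by (rule bij_betw_inv_into)
  have in_G: "\<psi> k \<in> hedges G" if "k \<in> hedges K" for k
    using \<psi> that bij_betwE by blast
  have \<phi>\<psi>: "\<phi> (\<psi> k) = k" if "k \<in> hedges K" for k
    unfolding \<psi>_def using bij that by (rule bij_betw_inv_into_right)
  have \<psi>\<phi>: "\<psi> (\<phi> h) = h" if "h \<in> hedges G" for h
    unfolding \<psi>_def using bij that by (rule bij_betw_inv_into_left)
  have 1: "\<psi> (mate K k) = mate G (\<psi> k) \<and> \<psi> (nxt K k) = nxt G (\<psi> k)" if "k \<in> hedges K" for k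
    using comm[OF in_G[OF that]] \<phi>\<psi>[OF that] \<psi>\<phi> in_G[OF that] G
    unfolding ut_graph_def by metis
  have 2: "colour G (\<psi> k) = colour K k" if "k \<in> univalent K" for k
  proof -
    have k: "k \<in> hedges K" "nxt K k = k" using that by (auto simp: univalent_def)
    then have "\<psi> k \<in> univalent G"
      using 1[OF k(1)] in_G[OF k(1)] by (simp add: univalent_def)
    then show ?thesis using col \<phi>\<psi>[OF k(1)] by metis
  qed
  show ?thesis unfolding ut_iso_def using G K \<psi> 1 2 by blast
qed

lemma ut_iso_trans:
  assumes "ut_iso G K" "ut_iso K L"
  shows "ut_iso G L"
proof -
  obtain \<phi> where \<phi>: "bij_betw \<phi> (hedges G) (hedges K)"
    "\<And>h. h \<in> hedges G \<Longrightarrow> \<phi> (mate G h) = mate K (\<phi> h) \<and> \<phi> (nxt G h) = nxt K (\<phi> h)"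
    "\<And>h. h \<in> univalent G \<Longrightarrow> colour K (\<phi> h) = colour G h"
    using assms(1) unfolding ut_iso_def by blast
  obtain \<psi> where \<psi>: "bij_betw \<psi> (hedges K) (hedges L)"
    "\<And>h. h \<in> hedges K \<Longrightarrow> \<psi> (mate K h) = mate L (\<psi> h) \<and> \<psi> (nxt K h) = nxt L (\<psi> h)"
    "\<And>h. h \<in> univalent K \<Longrightarrow> colour L (\<psi> h) = colour K h"
    using assms(2) unfolding ut_iso_def by blast
  have in_K: "\<phi> h \<in> hedges K" if "h \<in> hedges G" for h
    using \<phi>(1) that bij_betwE by blast
  have uni: "\<phi> h \<in> univalent K" if "h \<in> univalent G" for h
    using that \<phi>(2)[of h] in_K[of h] by (auto simp: univalent_def)
  have "bij_betw (\<psi> \<circ> \<phi>) (hedges G) (hedges L)"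
    using \<phi>(1) \<psi>(1) by (rule bij_betw_trans)
  then show ?thesis
    using assms \<phi>(2,3) \<psi>(2,3) in_K uni unfolding ut_iso_def
    by (intro conjI exI[of _ "\<psi> \<circ> \<phi>"]) auto
qed

definition empty_ut_graph :: "('h, 'y) ut_pregraph" where
  "empty_ut_graph = \<lparr>hedges = {}, mate = id, nxt = id, colour = undefined\<rparr>"

(* Isomorphism classes. Half-edges in nat lose no generality, since graphs are finite. *)

quotient_type 'y ut_class = "(nat, 'y) ut_pregraph" / partial: ut_iso
proof (rule part_equivpI)
  show "\<exists>G :: (nat, 'y) ut_pregraph. ut_iso G G"
    by (rule exI[of _ empty_ut_graph], rule ut_iso_refl) (simp add: ut_graph_def empty_ut_graph_def)
  show "symp (ut_iso :: (nat, 'y) ut_pregraph \<Rightarrow> _)"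
    using ut_iso_sym by (rule sympI)
  show "transp (ut_iso :: (nat, 'y) ut_pregraph \<Rightarrow> _)"
    using ut_iso_trans by (rule transpI)
qed

definition class_of :: "('h, 'y) ut_pregraph \<Rightarrow> 'y ut_class" where
  "class_of G = abs_ut_class (SOME G'. ut_iso G G')"

definition ut_sum :: "('h, 'y) ut_pregraph \<Rightarrow> ('k, 'y) ut_pregraph \<Rightarrow> ('h + 'k, 'y) ut_pregraph" where
  "ut_sum G K = \<lparr>hedges = hedges G <+> hedges K,
     mate = map_sum (mate G) (mate K),
     nxt = map_sum (nxt G) (nxt K),
     colour = case_sum (colour G) (colour K)\<rparr>"

definition ut_component :: "('h, 'y) ut_pregraph \<Rightarrow> 'h \<Rightarrow> 'h set" where
  "ut_component G h =
     ({(a, mate G a) | a. a \<in> hedges G} \<union> {(a, nxt G a) | a. a \<in> hedges G})\<^sup>* `` {h}"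

definition ut_components :: "('h, 'y) ut_pregraph \<Rightarrow> ('h, 'y) ut_pregraph set" where
  "ut_components G = {G\<lparr>hedges := ut_component G h\<rparr> | h. h \<in> hedges G}"

definition ut_connected :: "('h, 'y) ut_pregraph \<Rightarrow> bool" where
  "ut_connected G \<longleftrightarrow> hedges G \<noteq> {} \<and> (\<forall>h\<in>hedges G. ut_component G h = hedges G)"

definition is_strut :: "('h, 'y) ut_pregraph \<Rightarrow> bool" where
  "is_strut G \<longleftrightarrow> (\<exists>h. hedges G = {h, mate G h} \<and> univalent G = {h, mate G h})"

definition is_monochrome_strut :: "('h, 'y) ut_pregraph \<Rightarrow> bool" where
  "is_monochrome_strut G \<longleftrightarrow> is_strut G \<and> (\<forall>h\<in>hedges G. colour G (mate G h) = colour G h)"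

(* The algebra of formal series: a series is its family of coefficients. Coefficientwise infinite
   sums are written with Sum_any, which sums over the support and is 0 if the support is infinite. *)

type_synonym 'y ut_series = "'y ut_class \<Rightarrow> rat"

definition ut_series_over :: "'y set \<Rightarrow> 'y ut_series set" where
  "ut_series_over Y =
     {D. \<forall>g. D g \<noteq> 0 \<longrightarrow> colour (rep_ut_class g) ` univalent (rep_ut_class g) \<subseteq> Y}"

definition ut_series_s :: "'y set \<Rightarrow> 'y ut_series set" where
  "ut_series_s Y =
     {D \<in> ut_series_over Y.
        \<forall>g. D g \<noteq> 0 \<longrightarrow> (\<forall>K\<in>ut_components (rep_ut_class g). \<not> is_monochrome_strut K)}"

definition ut_strutless :: "'y ut_series \<Rightarrow> bool" where
  "ut_strutless D \<longleftrightarrow> (\<forall>g. D g \<noteq> 0 \<longrightarrow> (\<forall>K\<in>ut_components (rep_ut_class g). \<not> is_strut K))"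

definition ut_primitive :: "'y ut_series \<Rightarrow> bool" where
  "ut_primitive D \<longleftrightarrow> (\<forall>g. D g \<noteq> 0 \<longrightarrow> ut_connected (rep_ut_class g))"

definition ut_primitive_part :: "'y ut_series \<Rightarrow> 'y ut_series" where
  "ut_primitive_part D = (\<lambda>g. if ut_connected (rep_ut_class g) then D g else 0)"

definition ut_monomial :: "'y ut_class \<Rightarrow> 'y ut_series" where
  "ut_monomial g = (\<lambda>x. if x = g then 1 else 0)"

definition ut_prod :: "'y ut_series \<Rightarrow> 'y ut_series \<Rightarrow> 'y ut_series" where
  "ut_prod D E = (\<lambda>x. Sum_any (\<lambda>(g, h).
     D g * E h * ut_monomial (class_of (ut_sum (rep_ut_class g) (rep_ut_class h))) x))"

primrec ut_power :: "'y ut_series \<Rightarrow> nat \<Rightarrow> 'y ut_series" where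
  "ut_power D 0 = ut_monomial (class_of (empty_ut_graph :: (nat, _) ut_pregraph))"
| "ut_power D (Suc n) = ut_prod D (ut_power D n)"

definition ut_exp :: "'y ut_series \<Rightarrow> 'y ut_series" where
  "ut_exp D = (\<lambda>x. Sum_any (\<lambda>n. ut_power D n x / fact n))"

definition gluings :: "('h, 'y) ut_pregraph \<Rightarrow> ('k, 'y) ut_pregraph \<Rightarrow> ('h \<Rightarrow> 'k) set" where
  "gluings G K = {f \<in> univalent G \<rightarrow>\<^sub>E univalent K.
     inj_on f (univalent G) \<and> (\<forall>u\<in>univalent G. colour K (f u) = colour G u)}"

(* The univalent vertices u of G and f u of K disappear. The edge issuing from a surviving
   half-edge is followed, passing from each identified vertex to its partner, until another
   surviving half-edge is reached. (Several steps may be needed if struts are involved. If struts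
   of G and struts of K close up to a circle without vertices, that circle is discarded; this
   cannot occur if one of G and K has no strut component.) *)

definition glue_partner :: "('h \<Rightarrow> 'k) \<Rightarrow> 'h set \<Rightarrow> 'h + 'k \<Rightarrow> 'h + 'k" where
  "glue_partner f U = case_sum (\<lambda>u. Inr (f u)) (\<lambda>v. Inl (inv_into U f v))"

definition glue ::
  "('h \<Rightarrow> 'k) \<Rightarrow> ('h, 'y) ut_pregraph \<Rightarrow> ('k, 'y) ut_pregraph \<Rightarrow> ('h + 'k, 'y) ut_pregraph" where
  "glue f G K =
     (let S = ut_sum G K;
          U = univalent G;
          kept = hedges S - (Inl ` U \<union> Inr ` f ` U)
      in S\<lparr>hedges := kept,
           mate := (\<lambda>a. while (\<lambda>b. b \<notin> kept) (\<lambda>b. mate S (glue_partner f U b)) (mate S a))\<rparr>)"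

definition ut_diff_graph :: "'y ut_class \<Rightarrow> 'y ut_class \<Rightarrow> 'y ut_series" where
  "ut_diff_graph g h = (\<lambda>x. \<Sum>f\<in>gluings (rep_ut_class g) (rep_ut_class h).
     ut_monomial (class_of (glue f (rep_ut_class g) (rep_ut_class h))) x)"

(* If Y is finite, D and E are series over Y and one of them is strutless, then the sum below has
   finite support: a graph x arises from finitely many pairs (g, h) only. *)

definition ut_diff_op :: "'y ut_series \<Rightarrow> 'y ut_series \<Rightarrow> 'y ut_series" where
  "ut_diff_op D E = (\<lambda>x. Sum_any (\<lambda>(g, h). D g * E h * ut_diff_graph g h x))"

end

theory Submission
  imports Defs
begin

text \<open>
A series is an exponential of a primitive series if and only if its coefficients, once they are
multiplied by orders of automorphism groups, are multiplicative for disjoint unions and take the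
value 1 on the empty graph. The proof shows that \<open>ut_diff_op (ut_exp B) (ut_exp C)\<close> has this property.

Let \<open>weight D X\<close> be the coefficient of the class of \<open>X\<close> in \<open>D\<close> times the number of automorphisms of \<open>X\<close>.
The point of this normalisation is that each operation on series becomes a sum over the ways to take
one concrete graph \<open>X\<close> apart.

\<^item> For a product one sums over the unions of components of \<open>X\<close> (\<open>weight_ut_prod\<close>). Consequently, for
  primitive \<open>D\<close>, the weight of \<open>X\<close> in \<open>ut_exp D\<close> is the product of the weights in \<open>D\<close> of its
  components (\<open>weight_ut_exp\<close>).
\<^item> For the differential operator on strutless series one sums over coloured cuts (\<open>weight_ut_diff_op\<close>).
  When no struts are involved, an edge of \<open>X\<close> crosses from the first graph to the second at most once. So
  \<open>X\<close> remembers a gluing as a set of trivalent vertices, those coming from the first graph, together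
  with a colour for each edge leaving this set. There are finitely many cuts as there are finitely many
  colours; this also shows that the formal sums involved have finite support.

Both formulas rest on one bijection (\<open>bij_betw_paste\<close>): a gluing together with an isomorphism from the
glued graph to \<open>X\<close> amounts to a cut of \<open>X\<close> together with isomorphisms from the two given graphs to the two
pieces.

To cut a disjoint union is to cut its two parts independently, and the pieces are then disjoint
unions as well. As exponentials have multiplicative weights, so has the series in question
(\<open>weight_diff_op_exp_split\<close>), and its weight on the empty graph is 1. A series with these two
properties is the exponential of its primitive part (\<open>exp_primitive_part_eqI\<close>), because both sides
have the same weights on connected graphs.
\<close>

section \<open>Isomorphisms and isomorphism classes\<close>

text \<open>The maps are extensional, so that an isomorphism is determined by its values on half-edges and the
set of isomorphisms between two graphs is finite: these sets are going to be counted.\<close>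

definition isos :: "('h, 'y) ut_pregraph \<Rightarrow> ('k, 'y) ut_pregraph \<Rightarrow> ('h \<Rightarrow> 'k) set" where
  "isos G K = {\<phi> \<in> hedges G \<rightarrow>\<^sub>E hedges K. bij_betw \<phi> (hedges G) (hedges K) \<and>
     (\<forall>h\<in>hedges G. \<phi> (mate G h) = mate K (\<phi> h) \<and> \<phi> (nxt G h) = nxt K (\<phi> h)) \<and>
     (\<forall>h\<in>univalent G. colour K (\<phi> h) = colour G h)}"

lemma ut_graphD:
  assumes "ut_graph G"
  shows "finite (hedges G)"
    and "h \<in> hedges G \<Longrightarrow> mate G h \<in> hedges G"
    and "h \<in> hedges G \<Longrightarrow> mate G h \<noteq> h"
    and "h \<in> hedges G \<Longrightarrow> mate G (mate G h) = h"
    and "h \<in> hedges G \<Longrightarrow> nxt G h \<in> hedges G"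
    and "h \<in> hedges G \<Longrightarrow> nxt G (nxt G (nxt G h)) = h"
  using assms by (auto simp: ut_graph_def)

lemma isosD:
  assumes "\<phi> \<in> isos G K"
  shows "bij_betw \<phi> (hedges G) (hedges K)"
    and "h \<in> hedges G \<Longrightarrow> \<phi> h \<in> hedges K"
    and "h \<in> hedges G \<Longrightarrow> \<phi> (mate G h) = mate K (\<phi> h)"
    and "h \<in> hedges G \<Longrightarrow> \<phi> (nxt G h) = nxt K (\<phi> h)"
    and "h \<in> hedges G \<Longrightarrow> nxt G h = h \<Longrightarrow> colour K (\<phi> h) = colour G h"
    and "\<phi> \<in> extensional (hedges G)"
  using assms by (auto simp: isos_def univalent_def PiE_def)

lemma isosI:
  assumes "bij_betw \<phi> (hedges G) (hedges K)"
    and "\<phi> \<in> extensional (hedges G)"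
    and "\<And>h. h \<in> hedges G \<Longrightarrow> \<phi> (mate G h) = mate K (\<phi> h)"
    and "\<And>h. h \<in> hedges G \<Longrightarrow> \<phi> (nxt G h) = nxt K (\<phi> h)"
    and "\<And>h. h \<in> hedges G \<Longrightarrow> nxt G h = h \<Longrightarrow> colour K (\<phi> h) = colour G h"
  shows "\<phi> \<in> isos G K"
  using assms by (auto simp: isos_def univalent_def PiE_def dest: bij_betwE)

text \<open>Univalent vertices are reflected as well as preserved: applying \<^const>\<open>nxt\<close> is compatible with an
isomorphism, and an isomorphism is injective.\<close>

lemma isos_nxt_fixed_iff:
  assumes "\<phi> \<in> isos G K" "ut_graph G" "h \<in> hedges G"
  shows "nxt K (\<phi> h) = \<phi> h \<longleftrightarrow> nxt G h = h"
  using isosD[OF assms(1)] ut_graphD[OF assms(2)] assms(3)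
  by (metis bij_betw_inv_into_left)

lemma ut_iso_iff_isos: "ut_iso G K \<longleftrightarrow> ut_graph G \<and> ut_graph K \<and> isos G K \<noteq> {}"
proof
  assume L: "ut_iso G K"
  then obtain \<phi> where "ut_graph G" "ut_graph K" "bij_betw \<phi> (hedges G) (hedges K)"
    "\<forall>h\<in>hedges G. \<phi> (mate G h) = mate K (\<phi> h) \<and> \<phi> (nxt G h) = nxt K (\<phi> h)"
    "\<forall>h\<in>univalent G. colour K (\<phi> h) = colour G h"
    unfolding ut_iso_def by blast
  then have "restrict \<phi> (hedges G) \<in> isos G K"
    by (intro isosI) (auto simp: univalent_def ut_graphD)
  then show "ut_graph G \<and> ut_graph K \<and> isos G K \<noteq> {}"
    using \<open>ut_graph G\<close> \<open>ut_graph K\<close> by blast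
next
  assume "ut_graph G \<and> ut_graph K \<and> isos G K \<noteq> {}"
  then show "ut_iso G K" unfolding ut_iso_def isos_def by blast
qed

lemma ut_iso_graphD: "ut_iso G K \<Longrightarrow> ut_graph G" "ut_iso G K \<Longrightarrow> ut_graph K"
  by (simp_all add: ut_iso_def)

lemma ut_iso_cong:
  assumes "ut_graph G" "hedges K = hedges G"
    and "\<And>h. h \<in> hedges G \<Longrightarrow> mate K h = mate G h"
    and "\<And>h. h \<in> hedges G \<Longrightarrow> nxt K h = nxt G h"
    and "\<And>h. h \<in> hedges G \<Longrightarrow> nxt G h = h \<Longrightarrow> colour K h = colour G h"
  shows "ut_iso G K"
proof -
  have "ut_graph K" using assms unfolding ut_graph_def by auto
  then show ?thesis using assms unfolding ut_iso_def
    by (auto intro!: exI[of _ id] simp: univalent_def)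
qed

lemma finite_isos: "ut_graph G \<Longrightarrow> ut_graph K \<Longrightarrow> finite (isos G K)"
  by (rule finite_subset[of _ "hedges G \<rightarrow>\<^sub>E hedges K"])
     (auto simp: isos_def intro!: finite_PiE dest: ut_graphD)

lemma isos_compose:
  assumes "\<phi> \<in> isos G K" "\<psi> \<in> isos K L" "ut_graph G"
  shows "compose (hedges G) \<psi> \<phi> \<in> isos G L"
proof (rule isosI)
  show "bij_betw (compose (hedges G) \<psi> \<phi>) (hedges G) (hedges L)"
    using bij_betw_trans[OF isosD(1)[OF assms(1)] isosD(1)[OF assms(2)]]
    by (rule bij_betw_cong[THEN iffD1, rotated]) (simp add: compose_def)
  show "compose (hedges G) \<psi> \<phi> \<in> extensional (hedges G)" by (simp add: compose_def)
next
  fix h assume h: "h \<in> hedges G"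
  note 1 = isosD[OF assms(1)] and 2 = isosD[OF assms(2)] and 3 = ut_graphD[OF assms(3)]
  show "compose (hedges G) \<psi> \<phi> (mate G h) = mate L (compose (hedges G) \<psi> \<phi> h)"
    using h 1(2)[of h] by (simp add: compose_def 1(3) 2(3) 3)
  show "compose (hedges G) \<psi> \<phi> (nxt G h) = nxt L (compose (hedges G) \<psi> \<phi> h)"
    using h 1(2)[of h] by (simp add: compose_def 1(4) 2(4) 3)
  assume f: "nxt G h = h"
  show "colour L (compose (hedges G) \<psi> \<phi> h) = colour G h"
    using h f 1(2)[of h] 1(4)[of h] 1(5)[of h] 2(5)[of "\<phi> h"] by (simp add: compose_def)
qed

text \<open>Composition with a fixed isomorphism of the targets is injective. Applying this to the isomorphism
and to its inverse gives equal cardinalities without an explicit inverse on sets of isomorphisms;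
the same holds for the sources below.\<close>

lemma card_isos_le_target:
  assumes "ut_iso K L" "ut_graph G"
  shows "card (isos G K) \<le> card (isos G L)"
proof -
  obtain \<theta> where \<theta>: "\<theta> \<in> isos K L" and "ut_graph K" "ut_graph L"
    using assms(1) unfolding ut_iso_iff_isos by blast
  have "inj_on (compose (hedges G) \<theta>) (isos G K)"
  proof (rule inj_onI)
    fix \<phi> \<psi> assume A: "\<phi> \<in> isos G K" "\<psi> \<in> isos G K" and e: "compose (hedges G) \<theta> \<phi> = compose (hedges G) \<theta> \<psi>"
    have "\<phi> h = \<psi> h" if "h \<in> hedges G" for h
      using fun_cong[OF e, of h] that isosD(1)[OF \<theta>] isosD(2)[OF A(1) that] isosD(2)[OF A(2) that]
      by (auto simp: compose_def bij_betw_def inj_on_def)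
    then show "\<phi> = \<psi>" by (rule extensionalityI[OF isosD(6)[OF A(1)] isosD(6)[OF A(2)]])
  qed
  then show ?thesis
    by (rule card_inj_on_le) (auto intro: isos_compose[OF _ \<theta> assms(2)] finite_isos[OF assms(2) \<open>ut_graph L\<close>])
qed

lemma card_isos_le_source:
  assumes "ut_iso G K" "ut_graph L"
  shows "card (isos K L) \<le> card (isos G L)"
proof -
  obtain \<theta> where \<theta>: "\<theta> \<in> isos G K" and G: "ut_graph G" "ut_graph K"
    using assms(1) unfolding ut_iso_iff_isos by blast
  have "inj_on (\<lambda>\<phi>. compose (hedges G) \<phi> \<theta>) (isos K L)"
  proof (rule inj_onI)
    fix \<phi> \<psi> assume A: "\<phi> \<in> isos K L" "\<psi> \<in> isos K L" and e: "compose (hedges G) \<phi> \<theta> = compose (hedges G) \<psi> \<theta>"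
    have "\<phi> k = \<psi> k" if "k \<in> hedges K" for k
    proof -
      have "k \<in> \<theta> ` hedges G" using bij_betw_imp_surj_on[OF isosD(1)[OF \<theta>]] that by simp
      then obtain h where "h \<in> hedges G" "k = \<theta> h" by blast
      then show ?thesis using fun_cong[OF e, of h] by (simp add: compose_def)
    qed
    then show "\<phi> = \<psi>" by (rule extensionalityI[OF isosD(6)[OF A(1)] isosD(6)[OF A(2)]])
  qed
  then show ?thesis
    by (rule card_inj_on_le) (auto intro: isos_compose[OF \<theta> _ G(1)] finite_isos[OF G(1) assms(2)])
qed

lemma card_isos_le:
  assumes "ut_iso G G'" "ut_iso K K'"
  shows "card (isos G K) \<le> card (isos G' K')"
  using card_isos_le_target[OF assms(2) ut_iso_graphD(1)[OF assms(1)]]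
    card_isos_le_source[OF ut_iso_sym[OF assms(1)] ut_iso_graphD(2)[OF assms(2)]] by linarith

lemma card_isos_cong:
  assumes "ut_iso G G'" "ut_iso K K'"
  shows "card (isos G K) = card (isos G' K')"
  by (intro order.antisym card_isos_le assms assms[THEN ut_iso_sym])

text \<open>Transport of structure along an enumeration of the half-edges. It makes \<^const>\<open>class_of\<close> meaningful for
graphs on arbitrary types, such as the sum types on which gluings live.\<close>

lemma ut_iso_nat_graph:
  assumes "ut_graph G"
  shows "\<exists>G' :: (nat, 'y) ut_pregraph. ut_iso G G'"
proof -
  obtain e :: "_ \<Rightarrow> nat" where e: "bij_betw e (hedges G) {0..<card (hedges G)}"
    using ex_bij_betw_finite_nat ut_graphD(1)[OF assms] by blast
  define d where "d = inv_into (hedges G) e"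
  have d: "d (e h) = h" if "h \<in> hedges G" for h
    using e that by (simp add: d_def bij_betw_inv_into_left)
  define G' where "G' = \<lparr>hedges = e ` hedges G, mate = e \<circ> mate G \<circ> d,
     nxt = e \<circ> nxt G \<circ> d, colour = colour G \<circ> d\<rparr>"
  have inj: "e h = e k \<longleftrightarrow> h = k" if "h \<in> hedges G" "k \<in> hedges G" for h k
    using d that by metis
  have "ut_graph G'"
    using assms unfolding ut_graph_def G'_def by (auto simp: d inj)
  moreover have "bij_betw e (hedges G) (hedges G')"
    using e by (auto simp: G'_def bij_betw_def)
  moreover have "\<forall>h\<in>hedges G. e (mate G h) = mate G' (e h) \<and> e (nxt G h) = nxt G' (e h)"
    "\<forall>h\<in>univalent G. colour G' (e h) = colour G h"
    by (auto simp: G'_def d univalent_def)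
  ultimately show ?thesis using assms
    unfolding ut_iso_def by blast
qed

lemma ut_iso_rep_refl: "ut_iso (rep_ut_class g) (rep_ut_class g)"
  by (rule Quotient3_rep_reflp[OF Quotient3_ut_class])

lemma ut_graph_rep: "ut_graph (rep_ut_class g)"
  using ut_iso_rep_refl ut_iso_graphD(1) by blast

lemma ut_iso_rep_class_of:
  assumes "ut_graph G"
  shows "ut_iso G (rep_ut_class (class_of G))"
proof -
  define G' :: "(nat, _) ut_pregraph" where "G' = (SOME G'. ut_iso G G')"
  have 1: "ut_iso G G'" unfolding G'_def using ut_iso_nat_graph[OF assms] by (rule someI_ex)
  have "ut_iso G' (rep_ut_class (abs_ut_class G'))"
    using rep_abs_rsp[OF Quotient3_ut_class] ut_iso_refl[OF ut_iso_graphD(2)[OF 1]] by blast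
  then show ?thesis using 1 ut_iso_trans unfolding class_of_def G'_def by blast
qed

lemma class_of_rep [simp]: "class_of (rep_ut_class g) = g"
proof -
  have "ut_iso (rep_ut_class g) (rep_ut_class (class_of (rep_ut_class g)))"
    by (rule ut_iso_rep_class_of[OF ut_graph_rep])
  then show ?thesis by (simp add: Quotient3_rel_rep[OF Quotient3_ut_class])
qed

lemma class_of_eq_iff:
  assumes "ut_graph G" "ut_graph K"
  shows "class_of G = class_of K \<longleftrightarrow> ut_iso G K"
proof -
  have "class_of G = class_of K \<longleftrightarrow> ut_iso (rep_ut_class (class_of G)) (rep_ut_class (class_of K))"
    by (simp add: Quotient3_rel_rep[OF Quotient3_ut_class])
  then show ?thesis
    using ut_iso_rep_class_of[OF assms(1)] ut_iso_rep_class_of[OF assms(2)]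
    by (meson ut_iso_sym ut_iso_trans)
qed

section \<open>Coefficients weighted by automorphisms\<close>

text \<open>The coefficient of \<open>G\<close> times the order of its automorphism group. In passing from coefficients to
weights, sums over isomorphism classes with symmetry factors become sums over decompositions of one
concrete graph, in which every decomposition counts once.\<close>

definition weight :: "'y ut_series \<Rightarrow> ('h, 'y) ut_pregraph \<Rightarrow> rat" where
  "weight D G = D (class_of G) * of_nat (card (isos G G))"

lemma card_isos_self_pos: "ut_graph G \<Longrightarrow> card (isos G G) > 0"
  using ut_iso_refl[of G] finite_isos[of G G] by (auto simp: ut_iso_iff_isos card_gt_0_iff)

text \<open>The isomorphisms from \<open>G\<close> to \<open>K\<close>, if there are any, form a torsor under the automorphisms of \<open>K\<close>.\<close>

lemma card_isos:
  assumes "ut_graph G" "ut_graph K"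
  shows "card (isos G K) = (if class_of G = class_of K then card (isos K K) else 0)"
  using assms class_of_eq_iff[OF assms] card_isos_cong[of G K K K] ut_iso_refl[of K]
  by (auto simp: ut_iso_iff_isos)

lemma weight_cong: "ut_iso G K \<Longrightarrow> weight D G = weight D K"
  using class_of_eq_iff[of G K] card_isos_cong[of G K G K] ut_iso_graphD
  by (metis weight_def)

lemma weight_eq_0_iff: "ut_graph G \<Longrightarrow> weight D G = 0 \<longleftrightarrow> D (class_of G) = 0"
  using card_isos_self_pos[of G] by (simp add: weight_def)

lemma ut_series_eqI:
  assumes "\<And>g. weight D (rep_ut_class g) = weight E (rep_ut_class g)"
  shows "D = E"
proof
  fix g
  show "D g = E g"
    using assms[of g] card_isos_self_pos[OF ut_graph_rep[of g]] by (simp add: weight_def)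
qed

section \<open>Cutting and pasting graphs\<close>

text \<open>The half-edges on the \<open>T\<close> side of the edges that lead out of \<open>T\<close>. They are also used as names for
these edges.\<close>

definition cut_boundary :: "('h, 'y) ut_pregraph \<Rightarrow> 'h set \<Rightarrow> 'h set" where
  "cut_boundary X T = {t \<in> T. mate X t \<notin> T}"

text \<open>The piece of \<open>X\<close> carried by \<open>T\<close> after all edges leading out of \<open>T\<close> have been cut. The new univalent
vertex at a cut edge is the half-edge of \<open>X\<close> on the far side of the cut, coloured by \<open>c\<close>. Thus no new
half-edges are invented, both pieces of a cut have their half-edges in \<open>X\<close>, and the two univalent
vertices arising from one cut edge are interchanged by the mate involution of \<open>X\<close>.\<close>

definition cut_graph :: "('h, 'y) ut_pregraph \<Rightarrow> 'h set \<Rightarrow> ('h \<Rightarrow> 'y) \<Rightarrow> ('h, 'y) ut_pregraph" where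
  "cut_graph X T c = X\<lparr>hedges := T \<union> mate X ` T,
     nxt := (\<lambda>h. if h \<in> T then nxt X h else h),
     colour := (\<lambda>h. if h \<in> T then colour X h else c h)\<rparr>"

lemma cut_graph_simps [simp]:
  "hedges (cut_graph X T c) = T \<union> mate X ` T"
  "mate (cut_graph X T c) = mate X"
  "nxt (cut_graph X T c) h = (if h \<in> T then nxt X h else h)"
  "colour (cut_graph X T c) h = (if h \<in> T then colour X h else c h)"
  by (simp_all add: cut_graph_def)

text \<open>Such a set consists of whole vertices of \<open>X\<close>.\<close>

definition nxt_closed :: "('h, 'y) ut_pregraph \<Rightarrow> 'h set \<Rightarrow> bool" where
  "nxt_closed X T \<longleftrightarrow> T \<subseteq> hedges X \<and> (\<forall>t\<in>T. nxt X t \<in> T)"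

lemma nxt_closed_Diff:
  assumes "ut_graph X" "nxt_closed X T"
  shows "nxt_closed X (hedges X - T)"
  using assms unfolding nxt_closed_def
  by (metis DiffD1 DiffD2 DiffI Diff_subset ut_graphD(5,6))

lemma ut_graph_cut_graph:
  assumes "ut_graph X" "nxt_closed X T"
  shows "ut_graph (cut_graph X T c)"
  using assms unfolding ut_graph_def nxt_closed_def
  by (auto simp: finite_subset subset_iff) metis

lemma cut_boundary_Diff:
  assumes "ut_graph X" "T \<subseteq> hedges X"
  shows "cut_boundary X (hedges X - T) = mate X ` cut_boundary X T"
  using assms unfolding cut_boundary_def 
  by (force simp: ut_graphD image_iff subset_iff)

text \<open>Gluings of the univalent vertices in \<open>A\<close> only. Two choices of \<open>A\<close> matter: all univalent vertices,
which gives the gluings of the differential operator, and the empty set, which gives the disjoint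
union. So one counting argument serves both for the operator and for the product. The conditions on
mates say that the edge at a glued vertex does not end in another glued vertex, so that an edge of the
glued graph passes through at most one glued point.\<close>

definition partial_gluings ::
  "'h set \<Rightarrow> ('h, 'y) ut_pregraph \<Rightarrow> ('k, 'y) ut_pregraph \<Rightarrow> ('h \<Rightarrow> 'k) set" where
  "partial_gluings A G K = {f \<in> A \<rightarrow>\<^sub>E univalent K. inj_on f A \<and>
     (\<forall>u\<in>A. colour K (f u) = colour G u \<and> mate G u \<notin> A \<and> mate K (f u) \<notin> f ` A)}"

text \<open>The mate of a surviving half-edge is written down without iteration: because of the conditions in
\<^const>\<open>partial_gluings\<close>, crossing one glued point leads to a surviving half-edge.\<close>

definition partial_glue ::
  "('h \<Rightarrow> 'k) \<Rightarrow> 'h set \<Rightarrow> ('h, 'y) ut_pregraph \<Rightarrow> ('k, 'y) ut_pregraph \<Rightarrow> ('h + 'k, 'y) ut_pregraph" where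
  "partial_glue f A G K =
     \<lparr>hedges = Inl ` (hedges G - A) \<union> Inr ` (hedges K - f ` A),
      mate = case_sum
        (\<lambda>h. if mate G h \<in> A then Inr (mate K (f (mate G h))) else Inl (mate G h))
        (\<lambda>k. if mate K k \<in> f ` A then Inl (mate G (inv_into A f (mate K k))) else Inr (mate K k)),
      nxt = map_sum (nxt G) (nxt K),
      colour = case_sum (colour G) (colour K)\<rparr>"

lemma partial_glue_simps [simp]:
  "hedges (partial_glue f A G K) = Inl ` (hedges G - A) \<union> Inr ` (hedges K - f ` A)"
  "mate (partial_glue f A G K) (Inl h) =
     (if mate G h \<in> A then Inr (mate K (f (mate G h))) else Inl (mate G h))"
  "mate (partial_glue f A G K) (Inr k) =
     (if mate K k \<in> f ` A then Inl (mate G (inv_into A f (mate K k))) else Inr (mate K k))"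
  "nxt (partial_glue f A G K) (Inl h) = Inl (nxt G h)"
  "nxt (partial_glue f A G K) (Inr k) = Inr (nxt K k)"
  "colour (partial_glue f A G K) (Inl h) = colour G h"
  "colour (partial_glue f A G K) (Inr k) = colour K k"
  by (simp_all add: partial_glue_def)

lemma partial_gluingsD:
  assumes "f \<in> partial_gluings A G K"
  shows "f \<in> extensional A" "inj_on f A"
    and "u \<in> A \<Longrightarrow> f u \<in> hedges K" "u \<in> A \<Longrightarrow> nxt K (f u) = f u"
    and "u \<in> A \<Longrightarrow> colour K (f u) = colour G u"
    and "u \<in> A \<Longrightarrow> mate G u \<notin> A" "u \<in> A \<Longrightarrow> mate K (f u) \<notin> f ` A"
  using assms by (auto simp: partial_gluings_def univalent_def PiE_def)

lemma ut_graph_partial_glue: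
  assumes "ut_graph G" "ut_graph K" "A \<subseteq> univalent G" "f \<in> partial_gluings A G K"
  shows "ut_graph (partial_glue f A G K)"
proof -
  note G = ut_graphD[OF assms(1)] and K = ut_graphD[OF assms(2)] and f = partial_gluingsD[OF assms(4)]
  have A: "u \<in> hedges G" "nxt G u = u" if "u \<in> A" for u using assms(3) that by (auto simp: univalent_def)
  have nG: "nxt G h \<notin> A" if "h \<in> hedges G" "h \<notin> A" for h using A G(5,6) that by metis
  have nK: "nxt K k \<notin> f ` A" if "k \<in> hedges K" "k \<notin> f ` A" for k using f(3,4) K(5,6) that by (metis imageE)
  let ?P = "partial_glue f A G K"
  have Inl: "mate ?P (Inl h) \<in> hedges ?P \<and> mate ?P (Inl h) \<noteq> Inl h \<and> mate ?P (mate ?P (Inl h)) = Inl h"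
    if h: "h \<in> hedges G" "h \<notin> A" for h
  proof (cases "mate G h \<in> A")
    case True
    then show ?thesis using h f(3,7)[OF True] G(4) K(2,4) inv_into_f_f[OF f(2) True] by auto
  next
    case False
    then show ?thesis using h G(2,3,4) by auto
  qed
  have Inr: "mate ?P (Inr k) \<in> hedges ?P \<and> mate ?P (Inr k) \<noteq> Inr k \<and> mate ?P (mate ?P (Inr k)) = Inr k"
    if k: "k \<in> hedges K" "k \<notin> f ` A" for k
  proof (cases "mate K k \<in> f ` A")
    case True
    then obtain u where u: "u \<in> A" "mate K k = f u" by blast
    then have "k = mate K (f u)" using K(4) k by metis
    then show ?thesis using k u f(3,6)[OF u(1)] G(2,4) A(1)[OF u(1)] K(4) inv_into_f_f[OF f(2) u(1)] by auto
  next
    case False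
    then show ?thesis using k K(2,3,4) by auto
  qed
  have "finite (hedges ?P)" using G(1) K(1) by simp
  moreover have "\<forall>p\<in>hedges ?P. nxt ?P p \<in> hedges ?P \<and> nxt ?P (nxt ?P (nxt ?P p)) = p"
    using nG nK G(5,6) K(5,6) by auto
  moreover have "\<forall>p\<in>hedges ?P. mate ?P p \<in> hedges ?P \<and> mate ?P p \<noteq> p \<and> mate ?P (mate ?P p) = p"
    using Inl Inr unfolding partial_glue_simps(1) by blast
  ultimately show ?thesis unfolding ut_graph_def by blast
qed

text \<open>Given a cut of \<open>X\<close> and identifications \<open>\<alpha>\<close> and \<open>\<beta>\<close> of \<open>G\<close> and \<open>K\<close> with its two pieces, the vertices in
\<open>A\<close> are those sent to the new univalent vertices of the first piece. A vertex \<open>u\<close> in \<open>A\<close> faces, across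
its cut edge, the half-edge \<open>mate X (\<alpha> u)\<close>, which is the new univalent vertex of the second piece.\<close>

lemma glue_data_of_cut:
  assumes G: "ut_graph G" and K: "ut_graph K" and X: "ut_graph X" and A: "A \<subseteq> univalent G"
    and T: "nxt_closed X T"
    and \<alpha>: "\<alpha> \<in> isos G (cut_graph X T (\<kappa> \<circ> mate X))"
    and \<beta>: "\<beta> \<in> isos K (cut_graph X (hedges X - T) \<kappa>)"
    and \<alpha>A: "\<alpha> ` A = mate X ` cut_boundary X T"
  shows "\<And>h. h \<in> hedges G \<Longrightarrow> \<alpha> h \<in> T \<longleftrightarrow> h \<notin> A"
    and "\<alpha> ` (hedges G - A) = T"
    and "\<And>u. u \<in> A \<Longrightarrow> mate G u \<notin> A"
    and "\<And>u. u \<in> A \<Longrightarrow> \<exists>k\<in>hedges K. \<beta> k = mate X (\<alpha> u)"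
    and "\<And>k. k \<in> hedges K \<Longrightarrow> \<beta> k \<notin> T \<or> (\<exists>u\<in>A. \<beta> k = mate X (\<alpha> u))"
    and "\<And>u. u \<in> A \<Longrightarrow> mate X (\<alpha> u) \<in> T"
    and "\<And>u. u \<in> A \<Longrightarrow> \<kappa> (mate X (\<alpha> u)) = colour G u"
proof -
  note G = ut_graphD[OF G] and K = ut_graphD[OF K] and X = ut_graphD[OF X]
  note al = isosD[OF \<alpha>] and be = isosD[OF \<beta>]
  have AG: "u \<in> hedges G" "nxt G u = u" if "u \<in> A" for u using A that by (auto simp: univalent_def)
  have TX: "T \<subseteq> hedges X" using T by (simp add: nxt_closed_def)
  have mbd: "mate X ` cut_boundary X T = (T \<union> mate X ` T) - T"
    by (auto simp: cut_boundary_def)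
  have inj: "inj_on \<alpha> (hedges G)" and im: "\<alpha> ` hedges G = T \<union> mate X ` T"
    using al(1) by (auto simp: bij_betw_def)
  have AT: "\<alpha> u \<notin> T" "\<exists>t\<in>T. \<alpha> u = mate X t" if "u \<in> A" for u
    using \<alpha>A that unfolding mbd by blast+
  show 1: "\<alpha> h \<in> T \<longleftrightarrow> h \<notin> A" if h: "h \<in> hedges G" for h
  proof -
    have "h \<in> A" if "\<alpha> h \<notin> T"
    proof -
      have "\<alpha> h \<in> \<alpha> ` A" using that al(2)[OF h] unfolding \<alpha>A mbd by simp
      then obtain u where "u \<in> A" "\<alpha> h = \<alpha> u" by blast
      then show ?thesis using inj h AG by (metis inj_onD)
    qed
    then show ?thesis using AT by blast
  qed
  show "\<alpha> ` (hedges G - A) = T"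
  proof
    show "\<alpha> ` (hedges G - A) \<subseteq> T" using 1 by blast
    show "T \<subseteq> \<alpha> ` (hedges G - A)"
    proof
      fix t assume t: "t \<in> T"
      then have "t \<in> \<alpha> ` hedges G" using im by blast
      then show "t \<in> \<alpha> ` (hedges G - A)" using 1 t by blast
    qed
  qed
  show 6: "mate X (\<alpha> u) \<in> T" if "u \<in> A" for u
    using AT(2)[OF that] X(4) TX by auto
  show "mate G u \<notin> A" if u: "u \<in> A" for u
    using 6[OF u] 1[of "mate G u"] al(3)[of u] AG[OF u] G(2) by simp
  have im2: "\<beta> ` hedges K = (hedges X - T) \<union> mate X ` (hedges X - T)"
    using be(1) by (auto simp: bij_betw_def)
  show "\<exists>k\<in>hedges K. \<beta> k = mate X (\<alpha> u)" if u: "u \<in> A" for u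
  proof -
    have "\<alpha> u \<in> hedges X - T" using AT[OF u] TX X(2) by auto
    then have "mate X (\<alpha> u) \<in> \<beta> ` hedges K" unfolding im2 by blast
    then show ?thesis by fastforce
  qed
  show "\<beta> k \<notin> T \<or> (\<exists>u\<in>A. \<beta> k = mate X (\<alpha> u))" if k: "k \<in> hedges K" for k
  proof (rule disjCI)
    assume "\<not> (\<exists>u\<in>A. \<beta> k = mate X (\<alpha> u))"
    moreover {
      assume b: "\<beta> k \<in> T"
      have "\<beta> k \<in> (hedges X - T) \<union> mate X ` (hedges X - T)" using im2 k by blast
      then obtain w where w: "w \<in> hedges X" "w \<notin> T" "\<beta> k = mate X w" using b by blast
      then have "w = mate X (\<beta> k)" using X(4) by simp
      then have "w \<in> mate X ` cut_boundary X T" using b w unfolding mbd by blast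
      then obtain u where "u \<in> A" "w = \<alpha> u" unfolding \<alpha>A[symmetric] by blast
      then have "\<exists>u\<in>A. \<beta> k = mate X (\<alpha> u)" using w by blast
    }
    ultimately show "\<beta> k \<notin> T" by blast
  qed
  show "\<kappa> (mate X (\<alpha> u)) = colour G u" if u: "u \<in> A" for u
    using al(5)[of u] AG[OF u] AT(1)[OF u] by simp
qed

text \<open>Reassembling \<open>X\<close> from its pieces: \<open>u\<close> is glued to the vertex that faces it across the cut, and the two
identifications of the pieces together identify the glued graph with \<open>X\<close>.\<close>

definition paste :: "'h set \<Rightarrow> ('h, 'y) ut_pregraph \<Rightarrow> ('k, 'y) ut_pregraph \<Rightarrow> ('x, 'y) ut_pregraph \<Rightarrow>
    ('h \<Rightarrow> 'x) \<Rightarrow> ('k \<Rightarrow> 'x) \<Rightarrow> ('h \<Rightarrow> 'k) \<times> ('h + 'k \<Rightarrow> 'x)" where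
  "paste A G K X \<alpha> \<beta> =
     (let f = (\<lambda>u\<in>A. inv_into (hedges K) \<beta> (mate X (\<alpha> u)))
      in (f, restrict (case_sum \<alpha> \<beta>) (hedges (partial_glue f A G K))))"

text \<open>A colour \<open>\<kappa> t\<close> is attached to the cut edge named by the half-edge \<open>t\<close> in \<open>T\<close>. The half-edge \<open>t\<close> itself is
the new univalent vertex of the second piece; in the first piece the new vertex is \<open>mate X t\<close>, which
explains the composition with the mate involution. Extensionality makes \<open>\<kappa>\<close> unique.\<close>

definition cut_data :: "'h set \<Rightarrow> ('h, 'y) ut_pregraph \<Rightarrow> ('k, 'y) ut_pregraph \<Rightarrow> ('x, 'y) ut_pregraph \<Rightarrow>
    (('x set \<times> ('x \<Rightarrow> 'y)) \<times> ('h \<Rightarrow> 'x) \<times> ('k \<Rightarrow> 'x)) set" where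
  "cut_data A G K X = {((T, \<kappa>), \<alpha>, \<beta>). nxt_closed X T \<and> \<kappa> \<in> extensional (cut_boundary X T) \<and>
     \<alpha> \<in> isos G (cut_graph X T (\<kappa> \<circ> mate X)) \<and> \<beta> \<in> isos K (cut_graph X (hedges X - T) \<kappa>) \<and>
     \<alpha> ` A = mate X ` cut_boundary X T}"

lemma paste_eqD:
  assumes "paste A G K X \<alpha> \<beta> = (f, \<phi>)"
  shows "f = (\<lambda>u\<in>A. inv_into (hedges K) \<beta> (mate X (\<alpha> u)))"
    and "\<phi> = restrict (case_sum \<alpha> \<beta>) (hedges (partial_glue f A G K))"
proof -
  show f: "f = (\<lambda>u\<in>A. inv_into (hedges K) \<beta> (mate X (\<alpha> u)))"
    using assms unfolding paste_def Let_def prod.inject by (rule conjunct1[THEN sym])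
  show "\<phi> = restrict (case_sum \<alpha> \<beta>) (hedges (partial_glue f A G K))"
    using assms unfolding paste_def Let_def prod.inject f[symmetric] by (rule conjunct2[THEN sym])
qed

lemma paste_cut_data:
  assumes G: "ut_graph G" and K: "ut_graph K" and X: "ut_graph X" and A: "A \<subseteq> univalent G"
    and d: "((T, \<kappa>), \<alpha>, \<beta>) \<in> cut_data A G K X"
    and p: "paste A G K X \<alpha> \<beta> = (f, \<phi>)"
  shows "f \<in> partial_gluings A G K" and "\<phi> \<in> isos (partial_glue f A G K) X"
    and "\<And>u. u \<in> A \<Longrightarrow> \<beta> (f u) = mate X (\<alpha> u)"
    and "\<And>k. k \<in> hedges K \<Longrightarrow> \<beta> k \<notin> T \<longleftrightarrow> k \<notin> f ` A"
proof -
  note Gd = ut_graphD[OF G] and Kd = ut_graphD[OF K] and Xd = ut_graphD[OF X]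
  have T: "nxt_closed X T"
    and \<alpha>: "\<alpha> \<in> isos G (cut_graph X T (\<kappa> \<circ> mate X))"
    and \<beta>: "\<beta> \<in> isos K (cut_graph X (hedges X - T) \<kappa>)"
    and \<alpha>A: "\<alpha> ` A = mate X ` cut_boundary X T"
    using d by (auto simp: cut_data_def)
  note gd = glue_data_of_cut[OF G K X A T \<alpha> \<beta> \<alpha>A]
  note al = isosD[OF \<alpha>] and be = isosD[OF \<beta>]
  have AG: "u \<in> hedges G" "nxt G u = u" if "u \<in> A" for u using A that by (auto simp: univalent_def)
  have TX: "t \<in> hedges X" if "t \<in> T" for t using T that by (auto simp: nxt_closed_def)
  have f_def: "f = (\<lambda>u\<in>A. inv_into (hedges K) \<beta> (mate X (\<alpha> u)))"
    and \<phi>_def: "\<phi> = restrict (case_sum \<alpha> \<beta>) (hedges (partial_glue f A G K))"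
    by (fact paste_eqD[OF p])+
  have fu: "f u \<in> hedges K" "\<beta> (f u) = mate X (\<alpha> u)" if u: "u \<in> A" for u
  proof -
    have "mate X (\<alpha> u) \<in> \<beta> ` hedges K" using gd(4)[OF u] by (metis imageI)
    then show "f u \<in> hedges K" "\<beta> (f u) = mate X (\<alpha> u)"
      unfolding f_def using u by (simp_all add: inv_into_into f_inv_into_f)
  qed
  show "\<beta> (f u) = mate X (\<alpha> u)" if u: "u \<in> A" for u by (rule fu(2)[OF u])
  have injb: "k = k'" if "\<beta> k = \<beta> k'" "k \<in> hedges K" "k' \<in> hedges K" for k k'
    using be(1) that by (auto simp: bij_betw_def inj_on_def)
  have inja: "k = k'" if "\<alpha> k = \<alpha> k'" "k \<in> hedges G" "k' \<in> hedges G" for k k'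
    using al(1) that by (auto simp: bij_betw_def inj_on_def)
  have fA: "\<beta> k \<notin> T \<longleftrightarrow> k \<notin> f ` A" if k: "k \<in> hedges K" for k
    using gd(5)[OF k] gd(6) fu injb k by (metis image_iff)
  then show "\<And>k. k \<in> hedges K \<Longrightarrow> \<beta> k \<notin> T \<longleftrightarrow> k \<notin> f ` A" .
  have aX: "\<alpha> u \<in> hedges X" if "u \<in> A" for u
    using al(2)[OF AG(1)[OF that]] TX Xd(2) by auto
  have f1: "nxt K (f u) = f u" if u: "u \<in> A" for u
    using isos_nxt_fixed_iff[OF \<beta> K fu(1)[OF u]] gd(6)[OF u] fu(2)[OF u] by simp
  show f: "f \<in> partial_gluings A G K"
    unfolding partial_gluings_def
  proof (intro CollectI conjI ballI)
    show "f \<in> A \<rightarrow>\<^sub>E univalent K"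
      using fu f1 by (auto simp: univalent_def f_def)
    show "inj_on f A"
      using fu(2) aX AG(1) inja Xd(4) by (metis inj_onI)
    fix u assume u: "u \<in> A"
    show "colour K (f u) = colour G u"
      using be(5)[OF fu(1)[OF u] f1[OF u]] gd(6,7)[OF u] fu(2)[OF u] by simp
    show "mate G u \<notin> A" by (rule gd(3)[OF u])
    have "\<beta> (mate K (f u)) = \<alpha> u" using be(3)[OF fu(1)[OF u]] fu(2)[OF u] Xd(4) aX[OF u] by simp
    then have "\<beta> (mate K (f u)) \<notin> T" using gd(1)[OF AG(1)[OF u]] u by simp
    then show "mate K (f u) \<notin> f ` A" using fA Kd(2) fu(1)[OF u] by blast
  qed
  note fd = partial_gluingsD[OF f]
  let ?P = "partial_glue f A G K"
  have \<phi>l: "\<phi> (Inl h) = \<alpha> h" if "h \<in> hedges G" "h \<notin> A" for h using that by (auto simp: \<phi>_def)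
  have \<phi>r: "\<phi> (Inr k) = \<beta> k" if "k \<in> hedges K" "k \<notin> f ` A" for k using that by (auto simp: \<phi>_def)
  have bim: "\<beta> ` (hedges K - f ` A) = hedges X - T"
  proof
    show "\<beta> ` (hedges K - f ` A) \<subseteq> hedges X - T"
      using fA be(2) Xd(2) by fastforce
    show "hedges X - T \<subseteq> \<beta> ` (hedges K - f ` A)"
    proof
      fix x assume x: "x \<in> hedges X - T"
      then have "x \<in> \<beta> ` hedges K" using be(1) by (auto simp: bij_betw_def)
      then show "x \<in> \<beta> ` (hedges K - f ` A)" using fA x by auto
    qed
  qed
  have Gn: "nxt G h \<notin> A" if "h \<in> hedges G" "h \<notin> A" for h using AG Gd(5,6) that by metis
  have Kn: "nxt K k \<notin> f ` A" if "k \<in> hedges K" "k \<notin> f ` A" for k using fd(3,4) Kd(5,6) that by (metis imageE)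
  have bX: "\<beta> k \<in> hedges X" if "k \<in> hedges K" for k
    using be(2)[OF that] Xd(2) by auto
  have ab: "\<alpha> h \<noteq> \<beta> k" if "h \<in> hedges G" "h \<notin> A" "k \<in> hedges K" "k \<notin> f ` A" for h k
    using gd(1)[OF that(1)] fA[OF that(3)] that by auto
  show "\<phi> \<in> isos ?P X"
  proof (rule isosI)
    have "inj_on \<phi> (hedges ?P)"
    proof (rule inj_onI)
      fix x y assume "x \<in> hedges ?P" "y \<in> hedges ?P" "\<phi> x = \<phi> y"
      then show "x = y"
        using ab ab[symmetric] by (cases x; cases y) (auto simp: \<phi>l \<phi>r intro: inja injb)
    qed
    moreover have "\<phi> ` hedges ?P = \<alpha> ` (hedges G - A) \<union> \<beta> ` (hedges K - f ` A)"
      unfolding partial_glue_simps(1) image_Un image_image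
      by (intro arg_cong2[where f = "(\<union>)"] image_cong) (auto simp: \<phi>l \<phi>r)
    ultimately show "bij_betw \<phi> (hedges ?P) (hedges X)"
      unfolding bij_betw_def bim gd(2) using TX by auto
    show "\<phi> \<in> extensional (hedges ?P)" by (simp add: \<phi>_def)
    fix p assume p: "p \<in> hedges ?P"
    show "\<phi> (mate ?P p) = mate X (\<phi> p)"
    proof (cases p)
      case (Inl h)
      then have h: "h \<in> hedges G" "h \<notin> A" using p by auto
      show ?thesis
      proof (cases "mate G h \<in> A")
        case True
        have "\<beta> (mate K (f (mate G h))) = mate X (mate X (mate X (\<alpha> h)))"
          using be(3) fu[OF True] al(3)[OF h(1)] by simp
        also have "\<dots> = mate X (\<alpha> h)" using aX[OF True] al(3)[OF h(1)] Xd(4) by simp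
        finally show ?thesis using True h Inl fd(7)[OF True] fu(1)[OF True] Kd(2) by (simp add: \<phi>l \<phi>r)
      next
        case False
        then show ?thesis using h Inl Gd(2) al(3)[OF h(1)] by (simp add: \<phi>l)
      qed
    next
      case (Inr k)
      then have k: "k \<in> hedges K" "k \<notin> f ` A" using p by auto
      show ?thesis
      proof (cases "mate K k \<in> f ` A")
        case True
        then obtain u where u: "u \<in> A" "mate K k = f u" by blast
        have "\<alpha> (mate G u) = mate X (\<beta> k)"
          using be(3)[OF k(1)] fu[OF u(1)] u(2) al(3)[OF AG(1)[OF u(1)]] by simp
        then show ?thesis using True k Inr u fd(6)[OF u(1)] AG[OF u(1)] Gd(2)
          by (simp add: \<phi>l \<phi>r inv_into_f_f[OF fd(2)])
      next
        case False
        then show ?thesis using k Inr Kd(2) be(3)[OF k(1)] by (simp add: \<phi>r)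
      qed
    qed
    show "\<phi> (nxt ?P p) = nxt X (\<phi> p)"
    proof (cases p)
      case (Inl h)
      then show ?thesis using p Gd(5) Gn gd(1) al(4) by (auto simp: \<phi>l)
    next
      case (Inr k)
      then have k: "k \<in> hedges K" "k \<notin> f ` A" using p by auto
      then show ?thesis using Inr Kd(5) Kn[OF k] fA[OF k(1)] be(4)[OF k(1)] bX[OF k(1)] by (simp add: \<phi>r)
    qed
    assume n: "nxt ?P p = p"
    show "colour X (\<phi> p) = colour ?P p"
    proof (cases p)
      case (Inl h)
      then show ?thesis using p n gd(1) al(5)[of h] by (auto simp: \<phi>l)
    next
      case (Inr k)
      then have k: "k \<in> hedges K" "k \<notin> f ` A" using p by auto
      then show ?thesis using Inr n fA[OF k(1)] be(5)[OF k(1)] bX[OF k(1)] by (simp add: \<phi>r)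
    qed
  qed
qed

text \<open>The set \<open>T\<close> is recovered as the image of the surviving half-edges of \<open>G\<close>. On surviving half-edges \<open>\<alpha>\<close>
and \<open>\<beta>\<close> are restrictions of \<open>\<phi>\<close>; on a glued vertex each is forced because mates are preserved.
Finally \<open>\<kappa>\<close> is forced because colours are preserved.\<close>

lemma inj_on_paste:
  assumes G: "ut_graph G" and K: "ut_graph K" and X: "ut_graph X" and A: "A \<subseteq> univalent G"
  shows "inj_on (\<lambda>((T, \<kappa>), \<alpha>, \<beta>). paste A G K X \<alpha> \<beta>) (cut_data A G K X)"
proof -
  have AG: "u \<in> hedges G" "nxt G u = u" if "u \<in> A" for u using A that by (auto simp: univalent_def)
  have main: "T = T' \<and> \<kappa> = \<kappa>' \<and> \<alpha> = \<alpha>' \<and> \<beta> = \<beta>'"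
    if d: "((T, \<kappa>), \<alpha>, \<beta>) \<in> cut_data A G K X" and d': "((T', \<kappa>'), \<alpha>', \<beta>') \<in> cut_data A G K X"
      and e: "paste A G K X \<alpha> \<beta> = paste A G K X \<alpha>' \<beta>'" for T \<kappa> \<alpha> \<beta> T' \<kappa>' \<alpha>' \<beta>'
  proof -
    obtain f \<phi> where p: "paste A G K X \<alpha> \<beta> = (f, \<phi>)" by fastforce
    then have p': "paste A G K X \<alpha>' \<beta>' = (f, \<phi>)" using e by simp
    have c: "nxt_closed X T" "\<alpha> \<in> isos G (cut_graph X T (\<kappa> \<circ> mate X))"
      "\<beta> \<in> isos K (cut_graph X (hedges X - T) \<kappa>)" "\<alpha> ` A = mate X ` cut_boundary X T"
      "\<kappa> \<in> extensional (cut_boundary X T)"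
      using d by (auto simp: cut_data_def)
    have c': "nxt_closed X T'" "\<alpha>' \<in> isos G (cut_graph X T' (\<kappa>' \<circ> mate X))"
      "\<beta>' \<in> isos K (cut_graph X (hedges X - T') \<kappa>')" "\<alpha>' ` A = mate X ` cut_boundary X T'"
      "\<kappa>' \<in> extensional (cut_boundary X T')"
      using d' by (auto simp: cut_data_def)
    note g = glue_data_of_cut[OF G K X A c(1-4)] and g' = glue_data_of_cut[OF G K X A c'(1-4)]
    have \<phi>: "\<phi> = restrict (case_sum \<alpha> \<beta>) (hedges (partial_glue f A G K))"
      "\<phi> = restrict (case_sum \<alpha>' \<beta>') (hedges (partial_glue f A G K))"
      by (fact paste_eqD(2)[OF p] paste_eqD(2)[OF p'])+
    have a1: "\<alpha> h = \<alpha>' h" if "h \<in> hedges G" "h \<notin> A" for h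
      using fun_cong[OF \<phi>(1), of "Inl h"] fun_cong[OF \<phi>(2), of "Inl h"] that by simp
    have b1: "\<beta> k = \<beta>' k" if "k \<in> hedges K" "k \<notin> f ` A" for k
      using fun_cong[OF \<phi>(1), of "Inr k"] fun_cong[OF \<phi>(2), of "Inr k"] that by simp
    have T: "T = T'" using g(2) g'(2) a1 by (metis DiffD1 DiffD2 image_cong)
    have a2: "\<alpha> u = \<alpha>' u" if u: "u \<in> A" for u
    proof -
      have m: "mate G u \<in> hedges G" "mate G u \<notin> A" "mate G (mate G u) = u"
        using g(3)[OF u] AG[OF u] ut_graphD[OF G] by auto
      then show ?thesis
        using isosD(3)[OF c(2) m(1)] isosD(3)[OF c'(2) m(1)] a1[OF m(1,2)] by simp
    qed
    have a: "\<alpha> h = \<alpha>' h" if "h \<in> hedges G" for h using a1 a2 that by blast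
    then have \<alpha>: "\<alpha> = \<alpha>'" by (rule extensionalityI[OF isosD(6)[OF c(2)] isosD(6)[OF c'(2)]])
    have "\<beta> k = \<beta>' k" if "k \<in> hedges K" for k
      using b1[OF that] paste_cut_data(3)[OF G K X A d p] paste_cut_data(3)[OF G K X A d' p'] a2 by force
    then have \<beta>: "\<beta> = \<beta>'" by (rule extensionalityI[OF isosD(6)[OF c(3)] isosD(6)[OF c'(3)]])
    have "\<kappa> t = \<kappa>' t" if t: "t \<in> cut_boundary X T" for t
    proof -
      have "mate X t \<in> \<alpha> ` A" using t c(4) by blast
      then obtain u where u: "u \<in> A" "mate X t = \<alpha> u" by blast
      then have "t = mate X (\<alpha> u)"
        using t c(1) ut_graphD(4)[OF X, of t] by (auto simp: cut_boundary_def nxt_closed_def)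
      then show ?thesis using g(7)[OF u(1)] g'(7)[OF u(1)] \<alpha> by simp
    qed
    then have "\<kappa> = \<kappa>'" using c(5) c'(5) unfolding T[symmetric] by (metis extensionalityI)
    then show ?thesis using T \<alpha> \<beta> by simp
  qed
  show ?thesis
  proof (rule inj_onI)
    fix x y
    assume x: "x \<in> cut_data A G K X" and y: "y \<in> cut_data A G K X"
      and e: "(\<lambda>((T, \<kappa>), \<alpha>, \<beta>). paste A G K X \<alpha> \<beta>) x = (\<lambda>((T, \<kappa>), \<alpha>, \<beta>). paste A G K X \<alpha> \<beta>) y"
    obtain T \<kappa> \<alpha> \<beta> T' \<kappa>' \<alpha>' \<beta>' where "x = ((T, \<kappa>), \<alpha>, \<beta>)" "y = ((T', \<kappa>'), \<alpha>', \<beta>')"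
      by (metis prod.exhaust)
    then show "x = y" using x y e main[of T \<kappa> \<alpha> \<beta> T' \<kappa>' \<alpha>' \<beta>'] by simp
  qed
qed

text \<open>Transporting the glued points to \<open>X\<close> by \<open>\<phi>\<close> and cutting there yields the data. A glued vertex \<open>u\<close> of
\<open>G\<close> is sent by \<open>\<alpha>\<close> to the half-edge of \<open>K\<close> that its edge has been joined to, and symmetrically for \<open>\<beta>\<close>.\<close>

lemma paste_surj:
  assumes G: "ut_graph G" and K: "ut_graph K" and X: "ut_graph X" and A: "A \<subseteq> univalent G"
    and f: "f \<in> partial_gluings A G K" and \<phi>: "\<phi> \<in> isos (partial_glue f A G K) X"
  shows "\<exists>T \<kappa> \<alpha> \<beta>. ((T, \<kappa>), \<alpha>, \<beta>) \<in> cut_data A G K X \<and> paste A G K X \<alpha> \<beta> = (f, \<phi>)"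
proof -
  note Gd = ut_graphD[OF G] and Kd = ut_graphD[OF K] and Xd = ut_graphD[OF X]
  note fd = partial_gluingsD[OF f] and ph = isosD[OF \<phi>]
  let ?P = "partial_glue f A G K"
  have AG: "u \<in> hedges G" "nxt G u = u" if "u \<in> A" for u using A that by (auto simp: univalent_def)
  have Gn: "nxt G h \<notin> A" if "h \<in> hedges G" "h \<notin> A" for h using AG Gd(5,6) that by metis
  have Kn: "nxt K k \<notin> f ` A" if "k \<in> hedges K" "k \<notin> f ` A" for k using fd(3,4) Kd(5,6) that by (metis imageE)
  have inv: "inv_into A f (f u) = u" if "u \<in> A" for u by (rule inv_into_f_f[OF fd(2) that])
  define pl where "pl h = \<phi> (Inl h)" for h
  define pr where "pr k = \<phi> (Inr k)" for k
  have plX: "pl h \<in> hedges X" if "h \<in> hedges G" "h \<notin> A" for h unfolding pl_def using that ph(2) by auto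
  have prX: "pr k \<in> hedges X" if "k \<in> hedges K" "k \<notin> f ` A" for k unfolding pr_def using that ph(2) by auto
  have pl_inj: "pl h = pl h' \<longleftrightarrow> h = h'" if "h \<in> hedges G" "h \<notin> A" "h' \<in> hedges G" "h' \<notin> A" for h h'
    using ph(1) that inj_on_eq_iff[of \<phi> "hedges ?P" "Inl h" "Inl h'"] by (auto simp: pl_def bij_betw_def)
  have pr_inj: "pr h = pr h' \<longleftrightarrow> h = h'" if "h \<in> hedges K" "h \<notin> f ` A" "h' \<in> hedges K" "h' \<notin> f ` A" for h h'
    using ph(1) that inj_on_eq_iff[of \<phi> "hedges ?P" "Inr h" "Inr h'"] by (auto simp: pr_def bij_betw_def)
  have plr: "pl h \<noteq> pr k" if "h \<in> hedges G" "h \<notin> A" "k \<in> hedges K" "k \<notin> f ` A" for h k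
    using ph(1) that inj_on_eq_iff[of \<phi> "hedges ?P" "Inl h" "Inr k"] by (auto simp: pr_def pl_def bij_betw_def)
  \<comment> \<open>The structure of the glued graph, expressed in X through pl and pr.\<close>
  have pl_mate: "mate X (pl h) = (if mate G h \<in> A then pr (mate K (f (mate G h))) else pl (mate G h))"
    if "h \<in> hedges G" "h \<notin> A" for h
    using ph(3)[of "Inl h"] that by (auto simp: pl_def pr_def)
  have pr_mate: "mate X (pr k) = (if mate K k \<in> f ` A then pl (mate G (inv_into A f (mate K k))) else pr (mate K k))"
    if "k \<in> hedges K" "k \<notin> f ` A" for k
    using ph(3)[of "Inr k"] that by (auto simp: pl_def pr_def)
  have pl_nxt: "nxt X (pl h) = pl (nxt G h)" if "h \<in> hedges G" "h \<notin> A" for h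
    using ph(4)[of "Inl h"] that by (auto simp: pl_def)
  have pr_nxt: "nxt X (pr h) = pr (nxt K h)" if "h \<in> hedges K" "h \<notin> f ` A" for h
    using ph(4)[of "Inr h"] that by (auto simp: pr_def)
  have pl_col: "colour X (pl h) = colour G h" if "h \<in> hedges G" "h \<notin> A" "nxt G h = h" for h
    using ph(5)[of "Inl h"] that by (auto simp: pl_def)
  have pr_col: "colour X (pr h) = colour K h" if "h \<in> hedges K" "h \<notin> f ` A" "nxt K h = h" for h
    using ph(5)[of "Inr h"] that by (auto simp: pr_def)
  have mu: "mate G u \<in> hedges G" "mate G u \<notin> A" "mate G (mate G u) = u" if "u \<in> A" for u
    using that AG fd(6) Gd by auto
  have mf: "mate K (f u) \<in> hedges K" "mate K (f u) \<notin> f ` A" "mate K (mate K (f u)) = f u" if "u \<in> A" for u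
    using that fd(3,7) Kd by auto
  have mpl: "mate X (pl (mate G u)) = pr (mate K (f u))" if "u \<in> A" for u
    using pl_mate[OF mu(1,2)[OF that]] mu(3)[OF that] that by simp
  have mpr: "mate X (pr (mate K (f u))) = pl (mate G u)" if "u \<in> A" for u
    using pr_mate[OF mf(1,2)[OF that]] mf(3)[OF that] that inv[OF that] by simp
  define T where "T = pl ` (hedges G - A)"
  define \<alpha> where "\<alpha> = (\<lambda>h\<in>hedges G. if h \<in> A then pr (mate K (f h)) else pl h)"
  define \<beta> where "\<beta> = (\<lambda>k\<in>hedges K. if k \<in> f ` A then pl (mate G (inv_into A f k)) else pr k)"
  define \<kappa> where "\<kappa> = (\<lambda>t\<in>cut_boundary X T. colour G (inv_into A (\<lambda>u. pl (mate G u)) t))"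
  have W: "hedges X - T = pr ` (hedges K - f ` A)"
  proof -
    have "hedges X = \<phi> ` hedges ?P" using ph(1) by (simp add: bij_betw_def)
    also have "\<dots> = T \<union> pr ` (hedges K - f ` A)"
      by (auto simp: T_def pl_def pr_def image_iff)
    finally show ?thesis using plr unfolding T_def by blast
  qed
  have TX: "T \<subseteq> hedges X" using plX unfolding T_def by blast
  have pl_T: "pl h \<in> T" if "h \<in> hedges G" "h \<notin> A" for h using that by (auto simp: T_def)
  have pr_T: "pr k \<notin> T" if "k \<in> hedges K" "k \<notin> f ` A" for k using that plr[OF _ _ that] unfolding T_def by force
  have nT: "nxt_closed X T" unfolding nxt_closed_def using TX pl_nxt Gn Gd(5) by (auto simp: T_def)
  have bd: "cut_boundary X T = (\<lambda>u. pl (mate G u)) ` A"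
  proof
    show "cut_boundary X T \<subseteq> (\<lambda>u. pl (mate G u)) ` A"
    proof
      fix t assume t: "t \<in> cut_boundary X T"
      then obtain h where h: "h \<in> hedges G" "h \<notin> A" "t = pl h" by (auto simp: cut_boundary_def T_def)
      then have "mate G h \<in> A"
        using t pl_mate[OF h(1,2)] pl_T Gd(2) unfolding cut_boundary_def by (auto split: if_splits)
      then show "t \<in> (\<lambda>u. pl (mate G u)) ` A" using h Gd(4) by (auto simp: image_iff intro!: bexI[of _ "mate G h"])
    qed
    show "(\<lambda>u. pl (mate G u)) ` A \<subseteq> cut_boundary X T"
      using pl_T pr_T mpl mu mf by (auto simp: cut_boundary_def)
  qed
  have inj: "inj_on (\<lambda>u. pl (mate G u)) A"
  proof (rule inj_onI)
    fix u v assume "u \<in> A" "v \<in> A" "pl (mate G u) = pl (mate G v)"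
    then show "u = v" using pl_inj mu by metis
  qed
  have \<kappa>: "\<kappa> (pl (mate G u)) = colour G u" if "u \<in> A" for u
    using that inv_into_f_f[OF inj that] bd by (auto simp: \<kappa>_def)
  have \<alpha>l: "\<alpha> h = pl h" if "h \<in> hedges G" "h \<notin> A" for h using that by (simp add: \<alpha>_def)
  have \<alpha>r: "\<alpha> u = pr (mate K (f u))" if "u \<in> A" for u using that AG by (simp add: \<alpha>_def)
  have \<beta>r: "\<beta> k = pr k" if "k \<in> hedges K" "k \<notin> f ` A" for k using that by (simp add: \<beta>_def)
  have \<beta>l: "\<beta> (f u) = pl (mate G u)" if "u \<in> A" for u using that fd(3) inv by (simp add: \<beta>_def)
  have \<alpha>A: "\<alpha> ` A = mate X ` cut_boundary X T"
    unfolding bd image_image by (rule image_cong) (simp_all add: \<alpha>r mpl)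
  have hG: "hedges G = (hedges G - A) \<union> A" using AG by blast
  have hK: "hedges K = (hedges K - f ` A) \<union> f ` A" using fd(3) by blast
  have \<alpha>im: "\<alpha> ` hedges G = T \<union> mate X ` T"
  proof -
    have "\<alpha> ` hedges G = \<alpha> ` (hedges G - A) \<union> \<alpha> ` A" by (subst hG) (rule image_Un)
    also have "\<alpha> ` (hedges G - A) = T" unfolding T_def by (rule image_cong) (simp_all add: \<alpha>l)
    also have "T \<union> \<alpha> ` A = T \<union> mate X ` T" unfolding \<alpha>A by (auto simp: cut_boundary_def)
    finally show ?thesis .
  qed
  have \<beta>im: "\<beta> ` hedges K = (hedges X - T) \<union> mate X ` (hedges X - T)"
  proof -
    have "\<beta> ` hedges K = \<beta> ` (hedges K - f ` A) \<union> \<beta> ` f ` A" by (subst hK) (rule image_Un)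
    also have "\<beta> ` (hedges K - f ` A) = hedges X - T" unfolding W by (rule image_cong) (simp_all add: \<beta>r)
    also have "\<beta> ` f ` A = cut_boundary X T" unfolding bd image_image by (rule image_cong) (simp_all add: \<beta>l)
    also have "cut_boundary X T = mate X ` cut_boundary X (hedges X - T)"
      unfolding cut_boundary_Diff[OF X TX] image_image using TX Xd(4)
      by (auto simp: cut_boundary_def image_iff subset_iff)
    also have "(hedges X - T) \<union> mate X ` cut_boundary X (hedges X - T)
        = (hedges X - T) \<union> mate X ` (hedges X - T)"
      by (auto simp: cut_boundary_def)
    finally show ?thesis .
  qed
  have \<alpha>: "\<alpha> \<in> isos G (cut_graph X T (\<kappa> \<circ> mate X))"
  proof (rule isosI)
    have "inj_on \<alpha> (hedges G)"
    proof (rule inj_onI)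
      fix x y assume xy: "x \<in> hedges G" "y \<in> hedges G" "\<alpha> x = \<alpha> y"
      have "x = y" if "x \<in> A" "y \<in> A"
        using xy(3) that pr_inj mf fd(2) by (metis \<alpha>r inj_onD)
      then show "x = y" using xy pl_inj plr mf \<alpha>l \<alpha>r by metis
    qed
    then show "bij_betw \<alpha> (hedges G) (hedges (cut_graph X T (\<kappa> \<circ> mate X)))"
      using \<alpha>im by (simp add: bij_betw_def)
    show "\<alpha> \<in> extensional (hedges G)" by (simp add: \<alpha>_def)
    fix h assume h: "h \<in> hedges G"
    show "\<alpha> (mate G h) = mate (cut_graph X T (\<kappa> \<circ> mate X)) (\<alpha> h)"
    proof (cases "h \<in> A")
      case True
      then show ?thesis using mu mpr by (simp add: \<alpha>l \<alpha>r)
    next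
      case False
      then show ?thesis using pl_mate[OF h False] h Gd(2) by (simp add: \<alpha>l \<alpha>r)
    qed
    show "\<alpha> (nxt G h) = nxt (cut_graph X T (\<kappa> \<circ> mate X)) (\<alpha> h)"
    proof (cases "h \<in> A")
      case True
      then show ?thesis using AG pr_T mf by (simp add: \<alpha>r)
    next
      case False
      then show ?thesis using h Gn Gd(5) pl_T pl_nxt by (simp add: \<alpha>l)
    qed
    assume n: "nxt G h = h"
    show "colour (cut_graph X T (\<kappa> \<circ> mate X)) (\<alpha> h) = colour G h"
    proof (cases "h \<in> A")
      case True
      then show ?thesis using pr_T mf mpr \<kappa> by (simp add: \<alpha>r)
    next
      case False
      then show ?thesis using h pl_T pl_col n by (simp add: \<alpha>l)
    qed
  qed
  have \<beta>: "\<beta> \<in> isos K (cut_graph X (hedges X - T) \<kappa>)"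
  proof (rule isosI)
    have "inj_on \<beta> (hedges K)"
    proof (rule inj_onI)
      fix x y assume xy: "x \<in> hedges K" "y \<in> hedges K" "\<beta> x = \<beta> y"
      have 1: "x = y" if "x \<in> f ` A" "y \<in> f ` A"
        using that xy(3) \<beta>l inj by (auto dest: inj_onD)
      have 2: "\<beta> x \<in> T \<longleftrightarrow> x \<in> f ` A" if "x \<in> hedges K" for x
        using that \<beta>l \<beta>r pl_T pr_T mu by fastforce
      show "x = y"
      proof (cases "x \<in> f ` A")
        case True
        then show ?thesis using 1 2 xy by metis
      next
        case False
        then show ?thesis using 2 xy pr_inj \<beta>r by metis
      qed
    qed
    then show "bij_betw \<beta> (hedges K) (hedges (cut_graph X (hedges X - T) \<kappa>))"
      using \<beta>im by (simp add: bij_betw_def)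
    show "\<beta> \<in> extensional (hedges K)" by (simp add: \<beta>_def)
    fix k assume k: "k \<in> hedges K"
    consider u where "u \<in> A" "k = f u" | "k \<notin> f ` A" by blast
    note cs = this
    show "\<beta> (mate K k) = mate (cut_graph X (hedges X - T) \<kappa>) (\<beta> k)"
    proof (cases rule: cs)
      case 1
      then show ?thesis using mf mpl by (simp add: \<beta>l \<beta>r)
    next
      case 2
      show ?thesis
      proof (cases "mate K k \<in> f ` A")
        case True
        then obtain u where "u \<in> A" "mate K k = f u" by blast
        then show ?thesis using 2 pr_mate[OF k 2] k inv by (simp add: \<beta>l \<beta>r)
      next
        case False
        then show ?thesis using 2 pr_mate[OF k 2] k Kd(2) by (simp add: \<beta>r)
      qed
    qed
    show "\<beta> (nxt K k) = nxt (cut_graph X (hedges X - T) \<kappa>) (\<beta> k)"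
    proof (cases rule: cs)
      case 1
      then show ?thesis using fd(4) pl_T mu by (simp add: \<beta>l)
    next
      case 2
      then show ?thesis using k Kn Kd(5) pr_T prX pr_nxt by (simp add: \<beta>r)
    qed
    assume n: "nxt K k = k"
    show "colour (cut_graph X (hedges X - T) \<kappa>) (\<beta> k) = colour K k"
    proof (cases rule: cs)
      case 1
      then show ?thesis using pl_T mu fd(5) \<kappa> by (simp add: \<beta>l)
    next
      case 2
      then show ?thesis using k pr_T prX pr_col n by (simp add: \<beta>r)
    qed
  qed
  have d: "((T, \<kappa>), \<alpha>, \<beta>) \<in> cut_data A G K X"
    using nT \<alpha> \<beta> \<alpha>A by (simp add: cut_data_def \<kappa>_def)
  obtain f' \<phi>' where p: "paste A G K X \<alpha> \<beta> = (f', \<phi>')" by fastforce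
  have f': "f' = f"
  proof (rule extensionalityI[of _ A])
    show "f' \<in> extensional A" using paste_eqD(1)[OF p] by simp
    show "f \<in> extensional A" by (rule fd(1))
    fix u assume u: "u \<in> A"
    have "\<beta> (f' u) = \<beta> (f u)"
      using paste_cut_data(3)[OF G K X A d p u] u mpr by (simp add: \<alpha>r \<beta>l)
    moreover have "f' u \<in> hedges K"
      using partial_gluingsD(3)[OF paste_cut_data(1)[OF G K X A d p] u] .
    ultimately show "f' u = f u"
      using isosD(1)[OF \<beta>] fd(3)[OF u] by (auto simp: bij_betw_def inj_on_def)
  qed
  have "\<phi>' = \<phi>"
  proof (rule extensionalityI[of _ "hedges ?P"])
    show "\<phi>' \<in> extensional (hedges ?P)" using paste_eqD(2)[OF p] f' by simp
    show "\<phi> \<in> extensional (hedges ?P)" by (rule ph(6))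
    fix x assume x: "x \<in> hedges ?P"
    have "\<phi>' = restrict (case_sum \<alpha> \<beta>) (hedges ?P)" using paste_eqD(2)[OF p] f' by simp
    then show "\<phi>' x = \<phi> x" using x \<alpha>l \<beta>r by (auto simp: pl_def pr_def)
  qed
  then show ?thesis using d p f' by blast
qed

text \<open>The bijection behind all weight formulas: a gluing of \<open>G\<close> to \<open>K\<close> with an identification of the result
with \<open>X\<close> is the same as a cut of \<open>X\<close> with identifications of \<open>G\<close> and \<open>K\<close> with its two pieces.\<close>

theorem bij_betw_paste:
  assumes "ut_graph G" "ut_graph K" "ut_graph X" "A \<subseteq> univalent G"
  shows "bij_betw (\<lambda>((T, \<kappa>), \<alpha>, \<beta>). paste A G K X \<alpha> \<beta>) (cut_data A G K X)
     (SIGMA f:partial_gluings A G K. isos (partial_glue f A G K) X)"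
  unfolding bij_betw_def
proof (intro conjI equalityI subsetI inj_on_paste[OF assms])
  fix z assume "z \<in> (\<lambda>((T, \<kappa>), \<alpha>, \<beta>). paste A G K X \<alpha> \<beta>) ` cut_data A G K X"
  then obtain T \<kappa> \<alpha> \<beta> where "((T, \<kappa>), \<alpha>, \<beta>) \<in> cut_data A G K X" "z = paste A G K X \<alpha> \<beta>" by auto
  then show "z \<in> (SIGMA f:partial_gluings A G K. isos (partial_glue f A G K) X)"
    using paste_cut_data(1,2)[OF assms] by (cases "paste A G K X \<alpha> \<beta>") simp
next
  fix z assume "z \<in> (SIGMA f:partial_gluings A G K. isos (partial_glue f A G K) X)"
  then obtain f \<phi> where "z = (f, \<phi>)" "f \<in> partial_gluings A G K" "\<phi> \<in> isos (partial_glue f A G K) X" by auto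
  then show "z \<in> (\<lambda>((T, \<kappa>), \<alpha>, \<beta>). paste A G K X \<alpha> \<beta>) ` cut_data A G K X"
    using paste_surj[OF assms] by (force simp: image_iff)
qed

section \<open>Counting gluings\<close>

lemma finite_partial_gluings:
  assumes "ut_graph G" "ut_graph K" "A \<subseteq> univalent G"
  shows "finite (partial_gluings A G K)"
proof (rule finite_subset)
  show "partial_gluings A G K \<subseteq> A \<rightarrow>\<^sub>E univalent K" by (auto simp: partial_gluings_def)
  show "finite (A \<rightarrow>\<^sub>E univalent K)"
    using assms by (intro finite_PiE) (auto simp: univalent_def ut_graph_def intro: finite_subset)
qed

text \<open>The cardinality form of \<open>bij_betw_paste\<close>. Here \<open>S\<close> is the set of those cuts of \<open>X\<close> that can arise from
gluing along \<open>A\<close>.\<close>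

lemma sum_card_isos_partial_glue:
  assumes G: "ut_graph G" and K: "ut_graph K" and X: "ut_graph X" and A: "A \<subseteq> univalent G"
    and fin: "finite S" and S: "\<And>T \<kappa>. (T, \<kappa>) \<in> S \<Longrightarrow> nxt_closed X T"
    and iff: "cut_data A G K X = (SIGMA (T, \<kappa>):S. isos G (cut_graph X T (\<kappa> \<circ> mate X)) \<times>
       isos K (cut_graph X (hedges X - T) \<kappa>))"
  shows "(\<Sum>f\<in>partial_gluings A G K. card (isos (partial_glue f A G K) X)) =
    (\<Sum>(T, \<kappa>)\<in>S. card (isos G (cut_graph X T (\<kappa> \<circ> mate X))) *
       card (isos K (cut_graph X (hedges X - T) \<kappa>)))"
proof -
  have "(\<Sum>f\<in>partial_gluings A G K. card (isos (partial_glue f A G K) X)) =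
      card (SIGMA f:partial_gluings A G K. isos (partial_glue f A G K) X)"
    by (rule card_SigmaI[symmetric])
      (use finite_partial_gluings[OF G K A] ut_graph_partial_glue[OF G K A] finite_isos X in auto)
  also have "\<dots> = card (cut_data A G K X)"
    using bij_betw_same_card[OF bij_betw_paste[OF G K X A]] by simp
  also have "\<dots> = (\<Sum>(T, \<kappa>)\<in>S. card (isos G (cut_graph X T (\<kappa> \<circ> mate X)) \<times>
       isos K (cut_graph X (hedges X - T) \<kappa>)))"
    unfolding iff
    by (subst card_SigmaI) (use fin S G K in \<open>auto intro!: finite_isos ut_graph_cut_graph nxt_closed_Diff X simp: case_prod_unfold\<close>)
  finally show ?thesis by (simp add: card_cartesian_product)
qed

text \<open>Both products considered here are sums over pairs of classes \<open>g\<close>, \<open>h\<close> with integral structure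
constants \<open>c g h\<close>. If these count, up to the order of the automorphism group of \<open>X\<close>, the ways to
identify \<open>g\<close> and \<open>h\<close> with the pieces \<open>P s\<close> and \<open>Q s\<close> of a decomposition \<open>s\<close>, then only the pairs of
classes of such pieces contribute. As there are finitely many decompositions, the infinite sum has finite
support, and exchanging it with the sum over \<open>S\<close> leaves one pair for each \<open>s\<close>.\<close>

lemma weight_Sum_any_pairs:
  fixes D E :: "'y ut_series" and c :: "'y ut_class \<Rightarrow> 'y ut_class \<Rightarrow> rat"
  assumes X: "ut_graph X" and fin: "finite S"
    and PQ: "\<And>s. s \<in> S \<Longrightarrow> ut_graph (P s)" "\<And>s. s \<in> S \<Longrightarrow> ut_graph (Q s)"
    and c: "\<And>g h. D g \<noteq> 0 \<Longrightarrow> E h \<noteq> 0 \<Longrightarrow> c g h * of_nat (card (isos X X)) =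
       of_nat (\<Sum>s\<in>S. card (isos (rep_ut_class g) (P s)) * card (isos (rep_ut_class h) (Q s)))"
  shows "Sum_any (\<lambda>(g, h). D g * E h * c g h) * of_nat (card (isos X X)) =
    (\<Sum>s\<in>S. weight D (P s) * weight E (Q s))"
proof -
  define a :: "'y ut_class \<Rightarrow> 'y ut_class \<Rightarrow> _ \<Rightarrow> rat" where
    "a g h s = of_nat (card (isos (rep_ut_class g) (P s)) * card (isos (rep_ut_class h) (Q s)))" for g h s
  define Z where "Z = (\<lambda>s. (class_of (P s), class_of (Q s))) ` S"
  let ?n = "of_nat (card (isos X X)) :: rat"
  have n: "?n \<noteq> 0" using card_isos_self_pos[OF X] by simp
  have a: "a g h s = (if (g, h) = (class_of (P s), class_of (Q s))
      then of_nat (card (isos (P s) (P s)) * card (isos (Q s) (Q s))) else 0 :: rat)" if "s \<in> S" for g h s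
    using card_isos[OF ut_graph_rep PQ(1)[OF that], of g] card_isos[OF ut_graph_rep PQ(2)[OF that], of h]
    by (auto simp: a_def)
  have c': "D g * E h * c g h * ?n = (\<Sum>s\<in>S. D g * E h * a g h s)" for g h
  proof (cases "D g = 0 \<or> E h = 0")
    case False
    then have "c g h * ?n = (\<Sum>s\<in>S. a g h s)" using c[of g h] by (simp add: a_def)
    then have "D g * E h * (c g h * ?n) = D g * E h * (\<Sum>s\<in>S. a g h s)" by simp
    then show ?thesis by (simp only: sum_distrib_left mult.assoc)
  qed auto
  have supp: "D g * E h * c g h = 0" if "(g, h) \<notin> Z" for g h
  proof -
    have "D g * E h * c g h * ?n = 0"
      unfolding c' using that a by (intro sum.neutral) (auto simp: Z_def)
    then show ?thesis using n by simp
  qed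
  have "Sum_any (\<lambda>(g, h). D g * E h * c g h) = (\<Sum>(g, h)\<in>Z. D g * E h * c g h)"
  proof (rule Sum_any.expand_superset)
    show "finite Z" using fin by (simp add: Z_def)
    show "{p. (case p of (g, h) \<Rightarrow> D g * E h * c g h) \<noteq> 0} \<subseteq> Z"
    proof
      fix p assume "p \<in> {p. (case p of (g, h) \<Rightarrow> D g * E h * c g h) \<noteq> 0}"
      then show "p \<in> Z" using supp[of "fst p" "snd p"] by (cases "p \<in> Z") (simp_all add: case_prod_unfold)
    qed
  qed
  then have "Sum_any (\<lambda>(g, h). D g * E h * c g h) * ?n = (\<Sum>(g, h)\<in>Z. D g * E h * c g h * ?n)"
    by (simp add: sum_distrib_right case_prod_unfold)
  also have "\<dots> = (\<Sum>p\<in>Z. \<Sum>s\<in>S. D (fst p) * E (snd p) * a (fst p) (snd p) s)"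
    by (simp add: c' case_prod_unfold)
  also have "\<dots> = (\<Sum>s\<in>S. \<Sum>p\<in>Z. D (fst p) * E (snd p) * a (fst p) (snd p) s)"
    by (rule sum.swap)
  also have "\<dots> = (\<Sum>s\<in>S. weight D (P s) * weight E (Q s))"
  proof (rule sum.cong[OF refl])
    fix s assume s: "s \<in> S"
    have "(\<Sum>p\<in>Z. D (fst p) * E (snd p) * a (fst p) (snd p) s) =
      (\<Sum>p\<in>Z. if p = (class_of (P s), class_of (Q s)) then weight D (P s) * weight E (Q s) else 0)"
      by (rule sum.cong[OF refl]) (auto simp: a[OF s] weight_def)
    also have "\<dots> = weight D (P s) * weight E (Q s)"
      using fin s by (simp add: Z_def)
    finally show "(\<Sum>p\<in>Z. D (fst p) * E (snd p) * a (fst p) (snd p) s) = weight D (P s) * weight E (Q s)" .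
  qed
  finally show ?thesis .
qed

lemma ut_monomial_card_isos:
  assumes "ut_graph G" "ut_graph X"
  shows "ut_monomial (class_of G) (class_of X) * of_nat (card (isos X X)) = of_nat (card (isos G X))"
  using card_isos[OF assms] by (auto simp: ut_monomial_def)

section \<open>Closed sets and the product\<close>

abbreviation subgraph :: "('h, 'y) ut_pregraph \<Rightarrow> 'h set \<Rightarrow> ('h, 'y) ut_pregraph" where
  "subgraph X R \<equiv> X\<lparr>hedges := R\<rparr>"

text \<open>The unions of connected components.\<close>

definition closed_sets :: "('h, 'y) ut_pregraph \<Rightarrow> 'h set set" where
  "closed_sets X = {R. R \<subseteq> hedges X \<and> (\<forall>h\<in>R. mate X h \<in> R \<and> nxt X h \<in> R)}"

lemma closed_sets_eq: "closed_sets X = {R. nxt_closed X R \<and> cut_boundary X R = {}}"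
  by (auto simp: closed_sets_def nxt_closed_def cut_boundary_def)

lemma closed_sets_Diff:
  assumes "ut_graph X" "R \<in> closed_sets X"
  shows "hedges X - R \<in> closed_sets X"
proof -
  have R: "nxt_closed X R" "cut_boundary X R = {}" "R \<subseteq> hedges X"
    using assms(2) by (auto simp: closed_sets_eq nxt_closed_def)
  show ?thesis
    using nxt_closed_Diff[OF assms(1) R(1)] cut_boundary_Diff[OF assms(1) R(3)] R(2)
    by (simp add: closed_sets_eq)
qed

lemma finite_closed_sets: "ut_graph X \<Longrightarrow> finite (closed_sets X)"
  by (rule finite_subset[of _ "Pow (hedges X)"]) (auto simp: closed_sets_def ut_graphD)

lemma ut_graph_subgraph: "ut_graph X \<Longrightarrow> R \<in> closed_sets X \<Longrightarrow> ut_graph (subgraph X R)"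
  by (auto simp: ut_graph_def closed_sets_def intro: finite_subset)

lemma ut_iso_subgraph_cut_graph:
  assumes "ut_graph X" "R \<in> closed_sets X"
  shows "ut_iso (subgraph X R) (cut_graph X R c)"
  by (rule ut_iso_cong[OF ut_graph_subgraph[OF assms]]) (use assms in \<open>auto simp: closed_sets_def\<close>)

lemma ut_iso_ut_sum_partial_glue:
  assumes "ut_graph G" "ut_graph K"
  shows "ut_iso (ut_sum G K) (partial_glue f {} G K)"
proof (rule ut_iso_sym, rule ut_iso_cong)
  show "ut_graph (partial_glue f {} G K)"
  proof -
    have "ut_graph (partial_glue (\<lambda>_. undefined) {} G K)"
      by (rule ut_graph_partial_glue[OF assms]) (auto simp: partial_gluings_def)
    then show ?thesis by (simp add: partial_glue_def)
  qed
qed (auto simp: ut_sum_def Plus_def)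

text \<open>A disjoint union decomposition of \<open>X\<close> is a gluing along the empty set of vertices. Its cuts cut no edge,
so that they are the closed sets.\<close>

theorem weight_ut_prod:
  fixes X :: "('x, 'y) ut_pregraph"
  assumes X: "ut_graph X"
  shows "weight (ut_prod D E) X =
    (\<Sum>R\<in>closed_sets X. weight D (subgraph X R) * weight E (subgraph X (hedges X - R)))"
proof -
  \<comment> \<open>The colouring of an empty set of cut edges.\<close>
  let ?u = "\<lambda>_ :: 'x. undefined :: 'y"
  define S where "S = closed_sets X \<times> {?u}"
  have fin: "finite S" using finite_closed_sets[OF X] by (simp add: S_def)
  have "weight (ut_prod D E) X = Sum_any (\<lambda>(g, h).
     D g * E h * ut_monomial (class_of (ut_sum (rep_ut_class g) (rep_ut_class h))) (class_of X)) * of_nat (card (isos X X))"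
    by (simp add: weight_def ut_prod_def)
  also have "\<dots> = (\<Sum>s\<in>S. weight D (cut_graph X (fst s) (snd s \<circ> mate X)) * weight E (cut_graph X (hedges X - fst s) (snd s)))"
  proof (rule weight_Sum_any_pairs[OF X fin])
    fix s assume "s \<in> S"
    then show "ut_graph (cut_graph X (fst s) (snd s \<circ> mate X))" "ut_graph (cut_graph X (hedges X - fst s) (snd s))"
      by (auto simp: S_def closed_sets_eq intro!: ut_graph_cut_graph X nxt_closed_Diff)
  next
    fix g h :: "'y ut_class"
    let ?G = "rep_ut_class g" and ?K = "rep_ut_class h"
    have GK: "ut_graph ?G" "ut_graph ?K" by (rule ut_graph_rep)+
    have pg: "partial_gluings {} ?G ?K = {\<lambda>_. undefined}" by (auto simp: partial_gluings_def)
    have cd: "cut_data {} ?G ?K X = (SIGMA (T, \<kappa>):S. isos ?G (cut_graph X T (\<kappa> \<circ> mate X)) \<times>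
       isos ?K (cut_graph X (hedges X - T) \<kappa>))"
      by (auto simp: cut_data_def S_def closed_sets_eq)
    have iso: "ut_iso (ut_sum ?G ?K) (partial_glue (\<lambda>_. undefined) {} ?G ?K)"
      by (rule ut_iso_ut_sum_partial_glue[OF GK])
    have "ut_monomial (class_of (ut_sum ?G ?K)) (class_of X) * of_nat (card (isos X X)) =
      (of_nat (card (isos (ut_sum ?G ?K) X)) :: rat)"
      by (rule ut_monomial_card_isos[OF ut_iso_graphD(1)[OF iso] X])
    also have "card (isos (ut_sum ?G ?K) X) = card (isos (partial_glue (\<lambda>_. undefined) {} ?G ?K) X)"
      by (rule card_isos_cong[OF iso ut_iso_refl[OF X]])
    also have "\<dots> = (\<Sum>f\<in>partial_gluings {} ?G ?K. card (isos (partial_glue f {} ?G ?K) X))"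
      by (simp add: pg)
    also have "\<dots> = (\<Sum>(T, \<kappa>)\<in>S. card (isos ?G (cut_graph X T (\<kappa> \<circ> mate X))) *
       card (isos ?K (cut_graph X (hedges X - T) \<kappa>)))"
      by (rule sum_card_isos_partial_glue[OF GK X _ fin _ cd]) (auto simp: S_def closed_sets_eq)
    finally show "ut_monomial (class_of (ut_sum ?G ?K)) (class_of X) * of_nat (card (isos X X)) =
      (of_nat (\<Sum>s\<in>S. card (isos ?G (cut_graph X (fst s) (snd s \<circ> mate X))) *
       card (isos ?K (cut_graph X (hedges X - fst s) (snd s)))) :: rat)"
      by (simp add: case_prod_unfold)
  qed
  also have "\<dots> = (\<Sum>R\<in>closed_sets X. weight D (cut_graph X R (?u \<circ> mate X)) * weight E (cut_graph X (hedges X - R) ?u))"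
    unfolding S_def by (rule sum.reindex_bij_witness[of _ "\<lambda>R. (R, ?u)" fst]) auto
  also have "\<dots> = (\<Sum>R\<in>closed_sets X. weight D (subgraph X R) * weight E (subgraph X (hedges X - R)))"
    by (intro sum.cong refl arg_cong2[where f = "(*)"] weight_cong[symmetric]
         ut_iso_subgraph_cut_graph X closed_sets_Diff)
  finally show ?thesis .
qed

section \<open>The diagrammatic differential operator\<close>

text \<open>The absence of strut components, as a condition on half-edges.\<close>

definition no_struts :: "('h, 'y) ut_pregraph \<Rightarrow> bool" where
  "no_struts G \<longleftrightarrow> (\<forall>u\<in>univalent G. mate G u \<notin> univalent G)"

lemma gluings_eq:
  assumes "no_struts G" "no_struts K"
  shows "gluings G K = partial_gluings (univalent G) G K"
  using assms unfolding gluings_def partial_gluings_def no_struts_def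
  by (auto simp: PiE_def Pi_def image_iff) metis

text \<open>In the loop that defines the mate of a half-edge of the glued graph, a vertex of \<open>G\<close> reached by
following an edge is glued to a vertex of \<open>K\<close>, whose own mate is not univalent and therefore survives.
So the loop body runs at most once.\<close>

lemma ut_iso_glue_partial_glue:
  assumes G: "ut_graph G" and K: "ut_graph K" and ns: "no_struts G" "no_struts K"
    and f: "f \<in> gluings G K"
  shows "ut_iso (glue f G K) (partial_glue f (univalent G) G K)"
proof (rule ut_iso_sym, rule ut_iso_cong)
  let ?P = "partial_glue f (univalent G) G K"
  have f': "f \<in> partial_gluings (univalent G) G K" using f gluings_eq[OF ns] by simp
  note fd = partial_gluingsD[OF f']
  show "ut_graph ?P" by (rule ut_graph_partial_glue[OF G K order.refl f'])
  show h: "hedges (glue f G K) = hedges ?P"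
    by (auto simp: glue_def ut_sum_def Let_def)
  fix p assume p: "p \<in> hedges ?P"
  show "nxt (glue f G K) p = nxt ?P p" "colour (glue f G K) p = colour ?P p"
    by (auto simp: glue_def ut_sum_def Let_def partial_glue_def)
  let ?m = "map_sum (mate G) (mate K)"
  have m: "mate (glue f G K) p = while (\<lambda>b. b \<notin> hedges ?P) (\<lambda>b. ?m (glue_partner f (univalent G) b)) (?m p)"
    unfolding h[symmetric] by (simp add: glue_def ut_sum_def Let_def)
  have step1: "mate (glue f G K) p = ?m p" if "?m p \<in> hedges ?P"
    unfolding m using that by (subst while_unfold) simp
  have step2: "mate (glue f G K) p = ?m (glue_partner f (univalent G) (?m p))"
    if "?m p \<notin> hedges ?P" "?m (glue_partner f (univalent G) (?m p)) \<in> hedges ?P"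
    unfolding m using that by (subst while_unfold, subst while_unfold) simp
  show "mate (glue f G K) p = mate ?P p"
  proof (cases p)
    case (Inl a)
    then have a: "a \<in> hedges G" "a \<notin> univalent G" using p by auto
    show ?thesis
    proof (cases "mate G a \<in> univalent G")
      case True
      then show ?thesis using step2 Inl fd(3,7)[OF True] ut_graphD(2)[OF K]
        by (auto simp: glue_partner_def)
    next
      case False
      then show ?thesis using step1 Inl a ut_graphD(2)[OF G] by auto
    qed
  next
    case (Inr b)
    then have b: "b \<in> hedges K" "b \<notin> f ` univalent G" using p by auto
    show ?thesis
    proof (cases "mate K b \<in> f ` univalent G")
      case True
      then obtain u where u: "u \<in> univalent G" "mate K b = f u" by blast
      then have "u \<in> hedges G" by (simp add: univalent_def)
      then show ?thesis using True step2 Inr u fd(6)[OF u(1)] ut_graphD(2)[OF G]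
        by (auto simp: glue_partner_def inv_into_f_f[OF fd(2)])
    next
      case False
      then show ?thesis using step1 Inr b ut_graphD(2)[OF K] by auto
    qed
  qed
qed

text \<open>The cuts by which \<open>X\<close> can arise from gluing all univalent vertices of the first piece: the vertices of
the first piece that come from \<open>X\<close> must all be trivalent.\<close>

definition cuts :: "'y set \<Rightarrow> ('h, 'y) ut_pregraph \<Rightarrow> ('h set \<times> ('h \<Rightarrow> 'y)) set" where
  "cuts Y X = {(T, \<kappa>). nxt_closed X T \<and> T \<inter> univalent X = {} \<and> \<kappa> \<in> cut_boundary X T \<rightarrow>\<^sub>E Y}"

lemma finite_cuts:
  assumes "ut_graph X" "finite Y"
  shows "finite (cuts Y X)"
proof (rule finite_subset)
  show "cuts Y X \<subseteq> (SIGMA T:Pow (hedges X). cut_boundary X T \<rightarrow>\<^sub>E Y)"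
    by (auto simp: cuts_def nxt_closed_def)
  show "finite (SIGMA T:Pow (hedges X). cut_boundary X T \<rightarrow>\<^sub>E Y)"
    using assms by (intro finite_SigmaI finite_PiE)
      (auto simp: ut_graphD cut_boundary_def intro: finite_subset[OF _ ut_graphD(1)])
qed

lemma image_univalent_isos:
  assumes "\<phi> \<in> isos G K" "ut_graph G"
  shows "\<phi> ` univalent G = univalent K"
proof -
  have "x \<in> \<phi> ` univalent G" if x: "x \<in> univalent K" for x
  proof -
    have "x \<in> \<phi> ` hedges G" using x isosD(1)[OF assms(1)] by (simp add: bij_betw_def univalent_def)
    then obtain h where "h \<in> hedges G" "x = \<phi> h" by blast
    then show ?thesis using x isos_nxt_fixed_iff[OF assms] by (auto simp: univalent_def)
  qed
  moreover have "\<phi> h \<in> univalent K" if "h \<in> univalent G" for h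
    using that isosD(2,4)[OF assms(1), of h] by (auto simp: univalent_def)
  ultimately show ?thesis by blast
qed

text \<open>An isomorphism matches the univalent vertices of \<open>G\<close> with those of the first piece, which are the new ones
together with the univalent vertices of \<open>X\<close> in \<open>T\<close>. Exactly the new ones are hit if and only if the latter
do not exist. The colours of the cut edges are colours of univalent vertices of \<open>G\<close>.\<close>

lemma cut_data_univalent:
  assumes G: "ut_graph G" and K: "ut_graph K" and X: "ut_graph X" and Y: "colour G ` univalent G \<subseteq> Y"
  shows "cut_data (univalent G) G K X = (SIGMA (T, \<kappa>):cuts Y X. isos G (cut_graph X T (\<kappa> \<circ> mate X)) \<times>
       isos K (cut_graph X (hedges X - T) \<kappa>))"
proof -
  have "((T, \<kappa>), \<alpha>, \<beta>) \<in> cut_data (univalent G) G K X \<longleftrightarrow> (T, \<kappa>) \<in> cuts Y X \<and>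
     \<alpha> \<in> isos G (cut_graph X T (\<kappa> \<circ> mate X)) \<and> \<beta> \<in> isos K (cut_graph X (hedges X - T) \<kappa>)"
     for T \<kappa> \<alpha> \<beta>
  proof (cases "nxt_closed X T \<and> \<alpha> \<in> isos G (cut_graph X T (\<kappa> \<circ> mate X)) \<and> \<beta> \<in> isos K (cut_graph X (hedges X - T) \<kappa>)")
    case True
    then have T: "nxt_closed X T" and \<alpha>: "\<alpha> \<in> isos G (cut_graph X T (\<kappa> \<circ> mate X))"
       and \<beta>: "\<beta> \<in> isos K (cut_graph X (hedges X - T) \<kappa>)" by auto
    have TX: "T \<subseteq> hedges X" using T by (simp add: nxt_closed_def)
    have im: "\<alpha> ` univalent G = (T \<inter> univalent X) \<union> mate X ` cut_boundary X T"
      unfolding image_univalent_isos[OF \<alpha> G] using TX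
      by (auto simp: univalent_def cut_boundary_def)
    have disj: "(T \<inter> univalent X) \<inter> mate X ` cut_boundary X T = {}"
      by (auto simp: cut_boundary_def)
    have eq: "\<alpha> ` univalent G = mate X ` cut_boundary X T \<longleftrightarrow> T \<inter> univalent X = {}"
      unfolding im using disj by blast
    have "\<kappa> t \<in> Y" if A: "\<alpha> ` univalent G = mate X ` cut_boundary X T" and t: "t \<in> cut_boundary X T" for t
    proof -
      have "mate X t \<in> \<alpha> ` univalent G" using t A by blast
      then obtain u where u: "u \<in> univalent G" "mate X t = \<alpha> u" by blast
      have "mate X (mate X t) = t" using t TX ut_graphD(4)[OF X] by (auto simp: cut_boundary_def)
      then have "\<kappa> t = colour G u"
        using glue_data_of_cut(7)[OF G K X order.refl T \<alpha> \<beta> A u(1)] u(2) by simp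
      then show ?thesis using u Y by auto
    qed
    then show ?thesis using T \<alpha> \<beta> eq by (auto simp: cut_data_def cuts_def PiE_def)
  next
    case False
    then show ?thesis by (auto simp: cut_data_def cuts_def)
  qed
  then show ?thesis by auto
qed

text \<open>Finiteness of the set of colours enters here: a cut edge of \<open>X\<close> leaves no trace of the colour of the
vertices glued there, so one has to sum over all colours.\<close>

theorem weight_ut_diff_op:
  assumes X: "ut_graph X" and Y: "finite Y"
    and D: "\<And>g. D g \<noteq> 0 \<Longrightarrow> no_struts (rep_ut_class g) \<and> colour (rep_ut_class g) ` univalent (rep_ut_class g) \<subseteq> Y"
    and E: "\<And>h. E h \<noteq> 0 \<Longrightarrow> no_struts (rep_ut_class h)"
  shows "weight (ut_diff_op D E) X =
    (\<Sum>(T, \<kappa>)\<in>cuts Y X. weight D (cut_graph X T (\<kappa> \<circ> mate X)) * weight E (cut_graph X (hedges X - T) \<kappa>))"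
proof -
  note fin = finite_cuts[OF X Y]
  have "weight (ut_diff_op D E) X = Sum_any (\<lambda>(g, h). D g * E h * ut_diff_graph g h (class_of X)) * of_nat (card (isos X X))"
    by (simp add: weight_def ut_diff_op_def)
  also have "\<dots> = (\<Sum>s\<in>cuts Y X. weight D (cut_graph X (fst s) (snd s \<circ> mate X)) * weight E (cut_graph X (hedges X - fst s) (snd s)))"
  proof (rule weight_Sum_any_pairs[OF X fin])
    fix s assume "s \<in> cuts Y X"
    then show "ut_graph (cut_graph X (fst s) (snd s \<circ> mate X))" "ut_graph (cut_graph X (hedges X - fst s) (snd s))"
      by (auto simp: cuts_def intro!: ut_graph_cut_graph X nxt_closed_Diff)
  next
    fix g h assume gh: "D g \<noteq> 0" "E h \<noteq> 0"
    let ?G = "rep_ut_class g" and ?K = "rep_ut_class h" and ?U = "univalent (rep_ut_class g)"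
    have GK: "ut_graph ?G" "ut_graph ?K" by (rule ut_graph_rep)+
    have ns: "no_struts ?G" "no_struts ?K" and col: "colour ?G ` ?U \<subseteq> Y" using D[OF gh(1)] E[OF gh(2)] by auto
    have "ut_diff_graph g h (class_of X) * of_nat (card (isos X X)) =
      (\<Sum>f\<in>gluings ?G ?K. ut_monomial (class_of (glue f ?G ?K)) (class_of X) * of_nat (card (isos X X)))"
      by (simp add: ut_diff_graph_def sum_distrib_right)
    also have "\<dots> = (\<Sum>f\<in>gluings ?G ?K. of_nat (card (isos (partial_glue f ?U ?G ?K) X)))"
    proof (rule sum.cong[OF refl])
      fix f assume "f \<in> gluings ?G ?K"
      then have iso: "ut_iso (glue f ?G ?K) (partial_glue f ?U ?G ?K)"
        by (rule ut_iso_glue_partial_glue[OF GK ns])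
      show "ut_monomial (class_of (glue f ?G ?K)) (class_of X) * of_nat (card (isos X X)) =
          (of_nat (card (isos (partial_glue f ?U ?G ?K) X)) :: rat)"
        using ut_monomial_card_isos[OF ut_iso_graphD(1)[OF iso] X] card_isos_cong[OF iso ut_iso_refl[OF X]] by simp
    qed
    also have "\<dots> = of_nat (\<Sum>f\<in>partial_gluings ?U ?G ?K. card (isos (partial_glue f ?U ?G ?K) X))"
      by (simp add: gluings_eq[OF ns])
    also have "\<dots> = of_nat (\<Sum>(T, \<kappa>)\<in>cuts Y X. card (isos ?G (cut_graph X T (\<kappa> \<circ> mate X))) *
       card (isos ?K (cut_graph X (hedges X - T) \<kappa>)))"
      by (intro arg_cong[where f = of_nat] sum_card_isos_partial_glue[OF GK X order.refl fin _ cut_data_univalent[OF GK X col]])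
         (auto simp: cuts_def)
    finally show "ut_diff_graph g h (class_of X) * of_nat (card (isos X X)) =
      (of_nat (\<Sum>s\<in>cuts Y X. card (isos ?G (cut_graph X (fst s) (snd s \<circ> mate X))) *
       card (isos ?K (cut_graph X (hedges X - fst s) (snd s)))) :: rat)"
      by (simp add: case_prod_unfold)
  qed
  finally show ?thesis by (simp add: case_prod_unfold)
qed

section \<open>Components and the exponential series\<close>

definition component_sets :: "('h, 'y) ut_pregraph \<Rightarrow> 'h set set" where
  "component_sets X = ut_component X ` hedges X"

lemma in_ut_component_self: "h \<in> ut_component X h"
  by (simp add: ut_component_def)

lemma ut_component_subset_closed:
  assumes "R \<in> closed_sets X" "h \<in> R"
  shows "ut_component X h \<subseteq> R"
proof
  fix k assume "k \<in> ut_component X h"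
  then have "(h, k) \<in> ({(a, mate X a) | a. a \<in> hedges X} \<union> {(a, nxt X a) | a. a \<in> hedges X})\<^sup>*"
    by (simp add: ut_component_def)
  then show "k \<in> R"
    by (induction rule: rtrancl_induct) (use assms in \<open>auto simp: closed_sets_def\<close>)
qed

lemma hedges_closed: "ut_graph X \<Longrightarrow> hedges X \<in> closed_sets X"
  by (auto simp: closed_sets_def ut_graphD)

lemma ut_component_closed:
  assumes "ut_graph X" "h \<in> hedges X"
  shows "ut_component X h \<in> closed_sets X"
proof -
  have sub: "ut_component X h \<subseteq> hedges X"
    by (rule ut_component_subset_closed[OF hedges_closed[OF assms(1)] assms(2)])
  have "mate X k \<in> ut_component X h \<and> nxt X k \<in> ut_component X h" if "k \<in> ut_component X h" for k
    using that sub unfolding ut_component_def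
    by (auto intro: rtrancl_into_rtrancl)
  then show ?thesis using sub by (auto simp: closed_sets_def)
qed

text \<open>If \<open>h\<close> were not reachable from \<open>k\<close>, the complement of the component of \<open>k\<close> would be closed and contain
\<open>h\<close>, hence also \<open>k\<close>. Complements of closed sets are closed because \<^const>\<open>mate\<close> and \<^const>\<open>nxt\<close> are
permutations of finite order.\<close>

lemma ut_component_eq:
  assumes "ut_graph X" "h \<in> hedges X" "k \<in> ut_component X h"
  shows "ut_component X k = ut_component X h"
proof
  show sub: "ut_component X k \<subseteq> ut_component X h"
    by (rule ut_component_subset_closed[OF ut_component_closed[OF assms(1,2)] assms(3)])
  have k: "k \<in> hedges X" using ut_component_closed[OF assms(1,2)] assms(3) by (auto simp: closed_sets_def)
  have "h \<in> ut_component X k"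
  proof (rule ccontr)
    assume "h \<notin> ut_component X k"
    then have "ut_component X h \<subseteq> hedges X - ut_component X k"
      using ut_component_subset_closed[OF closed_sets_Diff[OF assms(1) ut_component_closed[OF assms(1) k]]] assms(2) by blast
    then show False using assms(3) in_ut_component_self[of k X] by blast
  qed
  then show "ut_component X h \<subseteq> ut_component X k"
    by (rule ut_component_subset_closed[OF ut_component_closed[OF assms(1) k]])
qed

lemma closed_sets_subgraph:
  "R \<in> closed_sets X \<Longrightarrow> closed_sets (subgraph X R) = {Q \<in> closed_sets X. Q \<subseteq> R}"
  by (auto simp: closed_sets_def)

lemma ut_component_subgraph:
  assumes X: "ut_graph X" and R: "R \<in> closed_sets X" and h: "h \<in> R"
  shows "ut_component (subgraph X R) h = ut_component X h"
proof
  have hX: "h \<in> hedges X" using R h by (auto simp: closed_sets_def)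
  show "ut_component (subgraph X R) h \<subseteq> ut_component X h"
    by (rule ut_component_subset_closed)
      (simp_all add: closed_sets_subgraph[OF R] ut_component_closed[OF X hX] ut_component_subset_closed[OF R h]
        in_ut_component_self)
  have "ut_component (subgraph X R) h \<in> closed_sets (subgraph X R)"
    using ut_component_closed[OF ut_graph_subgraph[OF X R]] h by simp
  then show "ut_component X h \<subseteq> ut_component (subgraph X R) h"
    by (intro ut_component_subset_closed) (simp_all add: closed_sets_subgraph[OF R] in_ut_component_self)
qed

lemma component_sets_closed: "ut_graph X \<Longrightarrow> c \<in> component_sets X \<Longrightarrow> c \<in> closed_sets X"
  by (auto simp: component_sets_def ut_component_closed)

lemma finite_component_sets: "ut_graph X \<Longrightarrow> finite (component_sets X)"
  by (simp add: component_sets_def ut_graphD)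

lemma component_sets_subgraph:
  assumes X: "ut_graph X" and R: "R \<in> closed_sets X"
  shows "component_sets (subgraph X R) = {c \<in> component_sets X. c \<subseteq> R}"
proof -
  have "component_sets (subgraph X R) = ut_component X ` R"
    using ut_component_subgraph[OF X R] by (auto simp: component_sets_def image_iff)
  also have "\<dots> = {c \<in> component_sets X. c \<subseteq> R}"
    using R ut_component_subset_closed[OF R] in_ut_component_self[of _ X]
    unfolding component_sets_def closed_sets_def by blast
  finally show ?thesis .
qed

lemma component_nonempty: "c \<in> component_sets X \<Longrightarrow> c \<noteq> {}"
  unfolding component_sets_def using in_ut_component_self[of _ X] by fastforce

lemma component_eqI:
  assumes X: "ut_graph X" and c: "c \<in> component_sets X" and d: "d \<in> component_sets X" "d \<subseteq> c"
  shows "d = c"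
proof -
  obtain k where k: "k \<in> d" using component_nonempty[OF d(1)] by blast
  have "ut_component X k = e" if "e \<in> component_sets X" "k \<in> e" for e
    using that ut_component_eq[OF X] by (auto simp: component_sets_def)
  then show ?thesis using c d k by blast
qed

lemma component_subset_or_disjoint:
  assumes X: "ut_graph X" and R: "R \<in> closed_sets X" and c: "c \<in> component_sets X"
  shows "c \<subseteq> R \<or> c \<subseteq> hedges X - R"
  using c ut_component_subset_closed[OF R] ut_component_subset_closed[OF closed_sets_Diff[OF X R]]
  by (auto simp: component_sets_def)

lemma component_sets_Un:
  assumes X: "ut_graph X" and R: "R \<in> closed_sets X"
  shows "component_sets X = component_sets (subgraph X R) \<union> component_sets (subgraph X (hedges X - R))"
    and "component_sets (subgraph X R) \<inter> component_sets (subgraph X (hedges X - R)) = {}"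
  unfolding component_sets_subgraph[OF X R] component_sets_subgraph[OF X closed_sets_Diff[OF X R]]
  using component_subset_or_disjoint[OF X R] component_nonempty by blast+

lemma component_sets_remove:
  assumes X: "ut_graph X" and c: "c \<in> component_sets X"
  shows "component_sets (subgraph X (hedges X - c)) = component_sets X - {c}"
proof -
  have cl: "c \<in> closed_sets X" by (rule component_sets_closed[OF X c])
  have "d = c" if "d \<in> component_sets X" "d \<subseteq> c" for d by (rule component_eqI[OF X c that])
  then show ?thesis
    unfolding component_sets_subgraph[OF X closed_sets_Diff[OF X cl]]
    using component_subset_or_disjoint[OF X cl] component_nonempty[of c X] c by blast
qed

lemma ut_connected_iff: "ut_connected X \<longleftrightarrow> component_sets X = {hedges X}"
  by (auto simp: ut_connected_def component_sets_def)

lemma ut_connected_subgraph_iff: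
  assumes X: "ut_graph X" and R: "R \<in> closed_sets X"
  shows "ut_connected (subgraph X R) \<longleftrightarrow> R \<in> component_sets X"
proof
  assume "ut_connected (subgraph X R)"
  then show "R \<in> component_sets X"
    using component_sets_subgraph[OF X R] by (auto simp: ut_connected_iff)
next
  assume c: "R \<in> component_sets X"
  have "d = R" if "d \<in> component_sets X" "d \<subseteq> R" for d by (rule component_eqI[OF X c that])
  then show "ut_connected (subgraph X R)"
    using c unfolding ut_connected_iff component_sets_subgraph[OF X R] by auto
qed

lemma ut_connected_iso:
  assumes "ut_iso G K" "ut_connected G"
  shows "ut_connected K"
proof -
  obtain \<phi> where \<phi>: "\<phi> \<in> isos G K" and G: "ut_graph G" and K: "ut_graph K"
    using assms(1) unfolding ut_iso_iff_isos by blast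
  note ph = isosD[OF \<phi>]
  have im: "\<phi> ` hedges G = hedges K" using ph(1) by (simp add: bij_betw_def)
  have "ut_component K k = hedges K" if k: "k \<in> hedges K" for k
  proof -
    let ?R = "ut_component K k" and ?Q = "{h \<in> hedges G. \<phi> h \<in> ut_component K k}"
    have R: "?R \<in> closed_sets K" by (rule ut_component_closed[OF K k])
    have Q: "?Q \<in> closed_sets G"
      using R ut_graphD[OF G] by (auto simp: closed_sets_def ph)
    obtain h where h: "h \<in> hedges G" "k = \<phi> h" using im k by blast
    then have "ut_component G h \<subseteq> ?Q"
      using in_ut_component_self[of k K] by (intro ut_component_subset_closed[OF Q]) simp
    then have "hedges G \<subseteq> ?Q" using assms(2) h by (auto simp: ut_connected_def)
    then have "\<phi> ` hedges G \<subseteq> ?R" by blast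
    then show ?thesis using R unfolding im closed_sets_def by blast
  qed
  then show ?thesis using assms(2) im by (auto simp: ut_connected_def)
qed

lemma ut_connected_rep_class_of:
  "ut_graph X \<Longrightarrow> ut_connected (rep_ut_class (class_of X)) \<longleftrightarrow> ut_connected X"
  by (rule iffI) (erule ut_connected_iso[rotated], simp add: ut_iso_rep_class_of ut_iso_sym)+

lemma weight_primitive:
  assumes "ut_primitive D" "ut_graph X" "\<not> ut_connected X"
  shows "weight D X = 0"
  using assms ut_connected_rep_class_of[OF assms(2)] by (auto simp: ut_primitive_def weight_def)

lemma weight_unit:
  assumes X: "ut_graph X"
  shows "weight (ut_monomial (class_of (empty_ut_graph :: (nat, 'y) ut_pregraph))) X =
     (if hedges X = {} then 1 else 0)"
proof -
  let ?e = "empty_ut_graph :: (nat, 'y) ut_pregraph"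
  have e: "ut_graph ?e" "hedges ?e = {}" "univalent ?e = {}"
    by (simp_all add: ut_graph_def empty_ut_graph_def univalent_def)
  have "isos ?e X = (if hedges X = {} then {\<lambda>_. undefined} else {})"
    by (auto simp: isos_def e bij_betw_def)
  then show ?thesis using ut_monomial_card_isos[OF e(1) X] by (simp add: weight_def)
qed

text \<open>In the product of \<open>D\<close> with a power, a closed set contributes only if it carries a connected
graph, so the first factor takes one component and the induction hypothesis deals with the others. Every
ordering of the components arises once, whence the factorial.\<close>

lemma weight_ut_power:
  assumes D: "ut_primitive D"
  shows "ut_graph X \<Longrightarrow> weight (ut_power D n) X =
    (if card (component_sets X) = n then fact n * (\<Prod>c\<in>component_sets X. weight D (subgraph X c)) else 0)"
proof (induction n arbitrary: X)
  case 0
  then show ?case using weight_unit[OF 0] finite_component_sets[OF 0]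
    by (auto simp: component_sets_def)
next
  case (Suc n)
  note X = Suc.prems and fin = finite_component_sets[OF Suc.prems]
  let ?C = "component_sets X"
  have "weight (ut_power D (Suc n)) X =
      (\<Sum>R\<in>closed_sets X. weight D (subgraph X R) * weight (ut_power D n) (subgraph X (hedges X - R)))"
    by (simp add: weight_ut_prod[OF X])
  also have "\<dots> = (\<Sum>c\<in>?C. weight D (subgraph X c) * weight (ut_power D n) (subgraph X (hedges X - c)))"
  proof (rule sum.mono_neutral_right[OF finite_closed_sets[OF X]])
    show "?C \<subseteq> closed_sets X" using component_sets_closed[OF X] by blast
    show "\<forall>R\<in>closed_sets X - ?C. weight D (subgraph X R) * weight (ut_power D n) (subgraph X (hedges X - R)) = 0"
      using weight_primitive[OF D] ut_graph_subgraph[OF X] ut_connected_subgraph_iff[OF X] by auto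
  qed
  also have "\<dots> = (\<Sum>c\<in>?C. if card ?C = Suc n then fact n * (\<Prod>c\<in>?C. weight D (subgraph X c)) else 0)"
  proof (rule sum.cong[OF refl])
    fix c assume c: "c \<in> ?C"
    have cl: "hedges X - c \<in> closed_sets X" by (rule closed_sets_Diff[OF X component_sets_closed[OF X c]])
    obtain m where "card ?C = Suc m" using c fin by (cases "card ?C") auto
    then show "weight D (subgraph X c) * weight (ut_power D n) (subgraph X (hedges X - c)) =
      (if card ?C = Suc n then fact n * (\<Prod>c\<in>?C. weight D (subgraph X c)) else 0)"
      unfolding Suc.IH[OF ut_graph_subgraph[OF X cl]] component_sets_remove[OF X c]
      using c fin by (simp add: prod.remove[OF fin c])
  qed
  also have "\<dots> = (if card ?C = Suc n then fact (Suc n) * (\<Prod>c\<in>?C. weight D (subgraph X c)) else 0)"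
    by simp
  finally show ?case .
qed

text \<open>Division by the factorial removes the orderings of the components, and all terms except the one whose
degree is the number of components vanish.\<close>

theorem weight_ut_exp:
  assumes D: "ut_primitive D" and X: "ut_graph X"
  shows "weight (ut_exp D) X = (\<Prod>c\<in>component_sets X. weight D (subgraph X c))"
proof -
  let ?n = "card (component_sets X)"
  have "ut_power D n (class_of X) = 0" if "n \<noteq> ?n" for n
    using weight_ut_power[OF D X, of n] weight_eq_0_iff[OF X] that by simp
  then have "ut_exp D (class_of X) = (\<Sum>n\<in>{?n}. ut_power D n (class_of X) / fact n)"
    unfolding ut_exp_def by (intro Sum_any.expand_superset) auto
  then have "weight (ut_exp D) X = weight (ut_power D ?n) X / fact ?n"
    by (simp add: weight_def)
  then show ?thesis using weight_ut_power[OF D X, of ?n] by simp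
qed

lemma weight_ut_exp_split:
  assumes D: "ut_primitive D" and X: "ut_graph X" and R: "R \<in> closed_sets X"
  shows "weight (ut_exp D) X = weight (ut_exp D) (subgraph X R) * weight (ut_exp D) (subgraph X (hedges X - R))"
proof -
  note cl = closed_sets_Diff[OF X R]
  have "finite (component_sets (subgraph X R))" "finite (component_sets (subgraph X (hedges X - R)))"
    by (intro finite_component_sets ut_graph_subgraph X R cl)+
  then show ?thesis
    unfolding weight_ut_exp[OF D X] weight_ut_exp[OF D ut_graph_subgraph[OF X R]]
      weight_ut_exp[OF D ut_graph_subgraph[OF X cl]] component_sets_Un(1)[OF X R]
    by (subst prod.union_disjoint) (simp_all add: component_sets_Un(2)[OF X R])
qed

lemma prod_component_sets:
  fixes M :: "('h, 'y) ut_pregraph \<Rightarrow> rat"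
  assumes split: "\<And>X R. ut_graph X \<Longrightarrow> R \<in> closed_sets X \<Longrightarrow> M X = M (subgraph X R) * M (subgraph X (hedges X - R))"
    and empty: "\<And>X. hedges X = {} \<Longrightarrow> M X = 1"
  shows "ut_graph X \<Longrightarrow> M X = (\<Prod>c\<in>component_sets X. M (subgraph X c))"
proof (induction "card (component_sets X)" arbitrary: X)
  case 0
  then have "hedges X = {}" using finite_component_sets[OF \<open>ut_graph X\<close>] by (simp add: component_sets_def)
  then show ?case using empty by (simp add: component_sets_def)
next
  case (Suc n)
  note X = \<open>ut_graph X\<close> and fin = finite_component_sets[OF \<open>ut_graph X\<close>]
  obtain c where c: "c \<in> component_sets X" using Suc(2) by fastforce
  have cl: "c \<in> closed_sets X" by (rule component_sets_closed[OF X c])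
  have "M (subgraph X (hedges X - c)) =
      (\<Prod>d\<in>component_sets X - {c}. M (subgraph (subgraph X (hedges X - c)) d))"
    using Suc(1)[of "subgraph X (hedges X - c)"] Suc(2) c fin ut_graph_subgraph[OF X closed_sets_Diff[OF X cl]]
    by (simp add: component_sets_remove[OF X c])
  then show ?case using split[OF X cl] by (simp add: prod.remove[OF fin c])
qed

text \<open>The criterion for being an exponential. A multiplicative weight is the product of its values on
components, and on connected graphs a series agrees with its primitive part, so that \<open>weight_ut_exp\<close>
yields the same product.\<close>

theorem exp_primitive_part_eqI:
  assumes split: "\<And>(X :: (nat, 'y) ut_pregraph) R. ut_graph X \<Longrightarrow> R \<in> closed_sets X \<Longrightarrow>
      weight F X = weight F (subgraph X R) * weight F (subgraph X (hedges X - R))"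
    and empty: "\<And>X :: (nat, 'y) ut_pregraph. hedges X = {} \<Longrightarrow> weight F X = 1"
  shows "F = ut_exp (ut_primitive_part F)"
proof (rule ut_series_eqI)
  fix g :: "'y ut_class"
  let ?X = "rep_ut_class g"
  have X: "ut_graph ?X" by (rule ut_graph_rep)
  have prim: "ut_primitive (ut_primitive_part F)"
    by (simp add: ut_primitive_def ut_primitive_part_def)
  have "weight F ?X = (\<Prod>c\<in>component_sets ?X. weight F (subgraph ?X c))"
    by (rule prod_component_sets[OF split empty X])
  also have "\<dots> = (\<Prod>c\<in>component_sets ?X. weight (ut_primitive_part F) (subgraph ?X c))"
  proof (rule prod.cong[OF refl])
    fix c assume c: "c \<in> component_sets ?X"
    have cl: "c \<in> closed_sets ?X" by (rule component_sets_closed[OF X c])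
    have "ut_connected (rep_ut_class (class_of (subgraph ?X c)))"
      using c ut_connected_subgraph_iff[OF X cl] ut_connected_rep_class_of[OF ut_graph_subgraph[OF X cl]] by simp
    then show "weight F (subgraph ?X c) = weight (ut_primitive_part F) (subgraph ?X c)"
      by (simp add: weight_def ut_primitive_part_def)
  qed
  finally show "weight F ?X = weight (ut_exp (ut_primitive_part F)) ?X"
    by (simp add: weight_ut_exp[OF prim X])
qed

section \<open>Multiplicativity of the differential operator\<close>

lemma no_struts_iso:
  assumes "ut_iso G K" "no_struts G"
  shows "no_struts K"
proof -
  obtain \<phi> where \<phi>: "\<phi> \<in> isos G K" and G: "ut_graph G"
    using assms(1) unfolding ut_iso_iff_isos by blast
  have "mate K (\<phi> u) \<notin> univalent K" if u: "u \<in> univalent G" for u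
  proof -
    have h: "u \<in> hedges G" "mate G u \<in> hedges G" using u ut_graphD(2)[OF G] by (auto simp: univalent_def)
    then have "nxt G (mate G u) \<noteq> mate G u" using assms(2) u by (auto simp: no_struts_def univalent_def)
    then show ?thesis
      using isos_nxt_fixed_iff[OF \<phi> G h(2)] isosD(3)[OF \<phi> h(1)] by (simp add: univalent_def)
  qed
  then show ?thesis
    unfolding no_struts_def image_univalent_isos[OF \<phi> G, symmetric] by blast
qed

lemma colours_iso:
  assumes "ut_iso G K"
  shows "colour K ` univalent K = colour G ` univalent G"
proof -
  obtain \<phi> where \<phi>: "\<phi> \<in> isos G K" and G: "ut_graph G"
    using assms unfolding ut_iso_iff_isos by blast
  show ?thesis
    unfolding image_univalent_isos[OF \<phi> G, symmetric] image_image
    by (rule image_cong[OF refl]) (simp add: isosD(5)[OF \<phi>] univalent_def)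
qed

lemma ut_strutless_no_struts:
  assumes "ut_strutless D" "D g \<noteq> 0"
  shows "no_struts (rep_ut_class g)"
  unfolding no_struts_def
proof (intro ballI notI)
  let ?X = "rep_ut_class g"
  fix u assume u: "u \<in> univalent ?X" and m: "mate ?X u \<in> univalent ?X"
  have X: "ut_graph ?X" by (rule ut_graph_rep)
  have uX: "u \<in> hedges ?X" using u by (simp add: univalent_def)
  have "{u, mate ?X u} \<in> closed_sets ?X"
    using u m ut_graphD(4)[OF X] by (auto simp: closed_sets_def univalent_def)
  then have "ut_component ?X u \<subseteq> {u, mate ?X u}" by (rule ut_component_subset_closed) simp
  moreover have "{u, mate ?X u} \<subseteq> ut_component ?X u"
    using ut_component_closed[OF X uX] in_ut_component_self[of u ?X] by (auto simp: closed_sets_def)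
  ultimately have c: "ut_component ?X u = {u, mate ?X u}" by blast
  have "is_strut (subgraph ?X (ut_component ?X u))"
    unfolding is_strut_def by (rule exI[of _ u]) (use u m in \<open>auto simp: c univalent_def\<close>)
  moreover have "subgraph ?X (ut_component ?X u) \<in> ut_components ?X"
    using uX by (auto simp: ut_components_def)
  ultimately show False using assms by (auto simp: ut_strutless_def)
qed

text \<open>If a product of weights over components does not vanish, then each component occurs in \<open>D\<close>, and both
properties can be checked on components.\<close>

lemma ut_exp_strutless:
  assumes D: "ut_primitive D" "ut_strutless D" "D \<in> ut_series_over Y" and g: "ut_exp D g \<noteq> 0"
  shows "no_struts (rep_ut_class g)"
    and "colour (rep_ut_class g) ` univalent (rep_ut_class g) \<subseteq> Y"
proof -
  let ?X = "rep_ut_class g"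
  have X: "ut_graph ?X" by (rule ut_graph_rep)
  have comp: "no_struts (subgraph ?X c)" "colour ?X ` univalent (subgraph ?X c) \<subseteq> Y"
    if c: "c \<in> component_sets ?X" for c
  proof -
    have gr: "ut_graph (subgraph ?X c)" using ut_graph_subgraph[OF X component_sets_closed[OF X c]] .
    have "weight (ut_exp D) ?X \<noteq> 0" using weight_eq_0_iff[OF X] g by simp
    then have "weight D (subgraph ?X c) \<noteq> 0"
      using c finite_component_sets[OF X] by (auto simp: weight_ut_exp[OF D(1) X])
    then have nz: "D (class_of (subgraph ?X c)) \<noteq> 0" by (simp add: weight_def)
    have iso: "ut_iso (subgraph ?X c) (rep_ut_class (class_of (subgraph ?X c)))"
      by (rule ut_iso_rep_class_of[OF gr])
    show "no_struts (subgraph ?X c)"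
      using no_struts_iso[OF ut_iso_sym[OF iso]] ut_strutless_no_struts[OF D(2) nz] .
    show "colour ?X ` univalent (subgraph ?X c) \<subseteq> Y"
      using colours_iso[OF iso] nz D(3) by (auto simp: ut_series_over_def)
  qed
  have u: "\<exists>c\<in>component_sets ?X. u \<in> univalent (subgraph ?X c) \<and> mate ?X u \<in> c" if "u \<in> univalent ?X" for u
  proof (rule bexI)
    have h: "u \<in> hedges ?X" using that by (simp add: univalent_def)
    then show "ut_component ?X u \<in> component_sets ?X" by (simp add: component_sets_def)
    show "u \<in> univalent (subgraph ?X (ut_component ?X u)) \<and> mate ?X u \<in> ut_component ?X u"
      using that ut_component_closed[OF X h] in_ut_component_self[of u ?X]
      by (auto simp: univalent_def closed_sets_def)
  qed
  show "no_struts ?X"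
    unfolding no_struts_def
  proof (intro ballI notI)
    fix v assume v: "v \<in> univalent ?X" and m: "mate ?X v \<in> univalent ?X"
    obtain c where "c \<in> component_sets ?X" "v \<in> univalent (subgraph ?X c)" "mate ?X v \<in> c" using u[OF v] by blast
    then show False using comp(1)[of c] m by (auto simp: no_struts_def univalent_def)
  qed
  show "colour ?X ` univalent ?X \<subseteq> Y" using u comp(2) by blast
qed

lemma cut_boundary_subgraph:
  assumes "R \<in> closed_sets X"
  shows "cut_boundary (subgraph X R) (T \<inter> R) = cut_boundary X T \<inter> R"
  using assms by (auto simp: cut_boundary_def closed_sets_def)

lemma nxt_closed_subgraph:
  assumes "R \<in> closed_sets X" "nxt_closed X T"
  shows "nxt_closed (subgraph X R) (T \<inter> R)"
  using assms by (auto simp: nxt_closed_def closed_sets_def)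

text \<open>Cutting edges separates components further, so a union of components of \<open>X\<close> still carries a union of
components of each piece.\<close>

lemma closed_sets_cut_graph:
  assumes "ut_graph X" "R \<in> closed_sets X" "nxt_closed X T"
  shows "hedges (cut_graph X T c) \<inter> R \<in> closed_sets (cut_graph X T c)"
  using assms ut_graphD(4)[OF assms(1)] by (auto simp: closed_sets_def nxt_closed_def subset_iff)

lemma closed_sets_mate_iff:
  assumes "ut_graph X" "R \<in> closed_sets X" "h \<in> hedges X"
  shows "mate X h \<in> R \<longleftrightarrow> h \<in> R"
  using assms(2) ut_graphD(4)[OF assms(1,3)] unfolding closed_sets_def mem_Collect_eq by metis

text \<open>Cutting commutes with restriction to a union of components. The two colourings only have to agree on the
new univalent vertices in \<open>R\<close>.\<close>

lemma ut_iso_subgraph_of_cut_graph: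
  assumes X: "ut_graph X" and R: "R \<in> closed_sets X" and T: "nxt_closed X T"
    and c: "\<And>h. h \<in> R \<Longrightarrow> h \<in> mate X ` cut_boundary X T \<Longrightarrow> c' h = c h"
  shows "ut_iso (subgraph (cut_graph X T c) (hedges (cut_graph X T c) \<inter> R)) (cut_graph (subgraph X R) (T \<inter> R) c')"
proof (rule ut_iso_cong)
  show "ut_graph (subgraph (cut_graph X T c) (hedges (cut_graph X T c) \<inter> R))"
    by (rule ut_graph_subgraph[OF ut_graph_cut_graph[OF X T] closed_sets_cut_graph[OF X R T]])
  have TX: "T \<subseteq> hedges X" using T by (simp add: nxt_closed_def)
  have m: "mate X t \<in> R \<longleftrightarrow> t \<in> R" if "t \<in> T" for t
    using closed_sets_mate_iff[OF X R] that TX by blast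
  show "hedges (cut_graph (subgraph X R) (T \<inter> R) c') =
      hedges (subgraph (cut_graph X T c) (hedges (cut_graph X T c) \<inter> R))"
    using m by auto
qed (use c in \<open>auto simp: cut_boundary_def\<close>)

lemma weight_exp_cut_graph_split:
  assumes D: "ut_primitive D" and X: "ut_graph X" and R: "R \<in> closed_sets X" and T: "nxt_closed X T"
    and c1: "\<And>h. h \<in> R \<Longrightarrow> h \<in> mate X ` cut_boundary X T \<Longrightarrow> c1 h = c h"
    and c2: "\<And>h. h \<in> hedges X - R \<Longrightarrow> h \<in> mate X ` cut_boundary X T \<Longrightarrow> c2 h = c h"
  shows "weight (ut_exp D) (cut_graph X T c) =
    weight (ut_exp D) (cut_graph (subgraph X R) (T \<inter> R) c1) *
    weight (ut_exp D) (cut_graph (subgraph X (hedges X - R)) (T \<inter> (hedges X - R)) c2)"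
proof -
  let ?Z = "cut_graph X T c"
  have R2: "hedges X - R \<in> closed_sets X" by (rule closed_sets_Diff[OF X R])
  have "hedges ?Z \<subseteq> hedges X" using T ut_graphD(2)[OF X] by (auto simp: nxt_closed_def)
  then have d: "hedges ?Z - (hedges ?Z \<inter> R) = hedges ?Z \<inter> (hedges X - R)" by blast
  have "weight (ut_exp D) ?Z = weight (ut_exp D) (subgraph ?Z (hedges ?Z \<inter> R)) *
      weight (ut_exp D) (subgraph ?Z (hedges ?Z \<inter> (hedges X - R)))"
    using weight_ut_exp_split[OF D ut_graph_cut_graph[OF X T, of c] closed_sets_cut_graph[OF X R T, of c]]
    by (simp only: d)
  also have "weight (ut_exp D) (subgraph ?Z (hedges ?Z \<inter> R)) = weight (ut_exp D) (cut_graph (subgraph X R) (T \<inter> R) c1)"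
    by (rule weight_cong[OF ut_iso_subgraph_of_cut_graph[OF X R T c1]])
  also have "weight (ut_exp D) (subgraph ?Z (hedges ?Z \<inter> (hedges X - R))) =
      weight (ut_exp D) (cut_graph (subgraph X (hedges X - R)) (T \<inter> (hedges X - R)) c2)"
    by (rule weight_cong[OF ut_iso_subgraph_of_cut_graph[OF X R2 T c2]])
  finally show ?thesis .
qed

lemma cuts_restrict:
  assumes R: "R \<in> closed_sets X" and s: "(T, \<kappa>) \<in> cuts Y X"
  shows "(T \<inter> R, restrict \<kappa> R) \<in> cuts Y (subgraph X R)"
  using s R nxt_closed_subgraph[OF R, of T] cut_boundary_subgraph[OF R, of T]
  by (auto simp: cuts_def univalent_def closed_sets_def PiE_def extensional_def)

lemma cuts_merge:
  assumes X: "ut_graph X" and R: "R \<in> closed_sets X"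
    and s1: "(T1, \<kappa>1) \<in> cuts Y (subgraph X R)" and s2: "(T2, \<kappa>2) \<in> cuts Y (subgraph X (hedges X - R))"
  shows "(T1 \<union> T2, \<lambda>h. if h \<in> R then \<kappa>1 h else \<kappa>2 h) \<in> cuts Y X"
proof -
  have T: "T1 \<subseteq> R" "T2 \<subseteq> hedges X - R" using s1 s2 by (auto simp: cuts_def nxt_closed_def)
  have R2: "hedges X - R \<in> closed_sets X" by (rule closed_sets_Diff[OF X R])
  have RX: "R \<subseteq> hedges X" using R by (auto simp: closed_sets_def)
  have i: "(T1 \<union> T2) \<inter> R = T1" "(T1 \<union> T2) \<inter> (hedges X - R) = T2" using T by auto
  have b: "cut_boundary (subgraph X R) T1 = cut_boundary X (T1 \<union> T2) \<inter> R"
    "cut_boundary (subgraph X (hedges X - R)) T2 = cut_boundary X (T1 \<union> T2) \<inter> (hedges X - R)"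
    using cut_boundary_subgraph[OF R, of "T1 \<union> T2"] cut_boundary_subgraph[OF R2, of "T1 \<union> T2"]
    unfolding i by auto
  have n: "nxt_closed X (T1 \<union> T2)" using s1 s2 RX by (auto simp: cuts_def nxt_closed_def)
  have u: "(T1 \<union> T2) \<inter> univalent X = {}" using s1 s2 T by (auto simp: cuts_def univalent_def)
  have sub: "cut_boundary X (T1 \<union> T2) \<subseteq> R \<union> (hedges X - R)" using T by (auto simp: cut_boundary_def)
  have "\<kappa>1 \<in> cut_boundary X (T1 \<union> T2) \<inter> R \<rightarrow>\<^sub>E Y"
    "\<kappa>2 \<in> cut_boundary X (T1 \<union> T2) \<inter> (hedges X - R) \<rightarrow>\<^sub>E Y"
    using s1 s2 unfolding b[symmetric] by (simp_all add: cuts_def)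
  then have "(\<lambda>h. if h \<in> R then \<kappa>1 h else \<kappa>2 h) \<in> cut_boundary X (T1 \<union> T2) \<rightarrow>\<^sub>E Y"
    using sub by (auto simp: PiE_def extensional_def Pi_def)
  then show ?thesis using n u by (simp add: cuts_def)
qed

text \<open>A cut of \<open>X\<close> is the same as a cut of \<open>R\<close> and an independent cut of its complement. The weights
of the two pieces, being weights of exponentials, split accordingly. Hence each summand is a
product, and the sum over pairs of cuts is the product of the sums.\<close>

theorem weight_diff_op_exp_split:
  fixes X :: "('x, 'y) ut_pregraph"
  assumes Y: "finite Y"
    and B: "ut_primitive B" "ut_strutless B" "B \<in> ut_series_over Y"
    and C: "ut_primitive C" "ut_strutless C" "C \<in> ut_series_over Y"
    and X: "ut_graph X" and R: "R \<in> closed_sets X"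
  defines "F \<equiv> ut_diff_op (ut_exp B) (ut_exp C)"
  shows "weight F X = weight F (subgraph X R) * weight F (subgraph X (hedges X - R))"
proof -
  define R' where "R' = hedges X - R"
  have R': "R' \<in> closed_sets X" unfolding R'_def by (rule closed_sets_Diff[OF X R])
  have RX: "R \<subseteq> hedges X" using R by (auto simp: closed_sets_def)
  define f where "f X' s = weight (ut_exp B) (cut_graph X' (fst s) (snd s \<circ> mate X')) *
     weight (ut_exp C) (cut_graph X' (hedges X' - fst s) (snd s))" for X' :: "('x, 'y) ut_pregraph" and s
  have F: "weight F X' = (\<Sum>s\<in>cuts Y X'. f X' s)" if "ut_graph X'" for X' :: "('x, 'y) ut_pregraph"
    unfolding F_def f_def
    by (subst weight_ut_diff_op[OF that Y]) (use ut_exp_strutless[OF B] ut_exp_strutless[OF C] in \<open>auto simp: case_prod_unfold\<close>)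
  define r1 where "r1 s = (fst s \<inter> R, restrict (snd s) R)" for s :: "'x set \<times> ('x \<Rightarrow> 'y)"
  define r2 where "r2 s = (fst s \<inter> R', restrict (snd s) R')" for s :: "'x set \<times> ('x \<Rightarrow> 'y)"
  have split: "f X s = f (subgraph X R) (r1 s) * f (subgraph X R') (r2 s)" if s: "s \<in> cuts Y X" for s
  proof -
    obtain T \<kappa> where s_eq: "s = (T, \<kappa>)" by fastforce
    have T: "nxt_closed X T" using s by (simp add: cuts_def s_eq)
    have TX: "T \<subseteq> hedges X" using T by (simp add: nxt_closed_def)
    have W: "nxt_closed X (hedges X - T)" by (rule nxt_closed_Diff[OF X T])
    have m: "mate X h \<in> R \<longleftrightarrow> h \<in> R" if "h \<in> hedges X" for h
      by (rule closed_sets_mate_iff[OF X R that])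
    have m': "mate X h \<in> R' \<longleftrightarrow> h \<in> R'" if "h \<in> hedges X" for h
      using m[OF that] that ut_graphD(2)[OF X] by (auto simp: R'_def)
    have e: "(hedges X - T) \<inter> R = R - T \<inter> R" "(hedges X - T) \<inter> R' = R' - T \<inter> R'"
      using RX by (auto simp: R'_def)
    have 1: "weight (ut_exp B) (cut_graph X T (\<kappa> \<circ> mate X)) =
       weight (ut_exp B) (cut_graph (subgraph X R) (T \<inter> R) (restrict \<kappa> R \<circ> mate X)) *
       weight (ut_exp B) (cut_graph (subgraph X R') (T \<inter> R') (restrict \<kappa> R' \<circ> mate X))"
      unfolding R'_def
      by (rule weight_exp_cut_graph_split[OF B(1) X R T])
        (use m m' R' RX in \<open>auto simp: closed_sets_def R'_def\<close>)
    have 2: "weight (ut_exp C) (cut_graph X (hedges X - T) \<kappa>) =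
       weight (ut_exp C) (cut_graph (subgraph X R) ((hedges X - T) \<inter> R) (restrict \<kappa> R)) *
       weight (ut_exp C) (cut_graph (subgraph X R') ((hedges X - T) \<inter> R') (restrict \<kappa> R'))"
      unfolding R'_def
      by (rule weight_exp_cut_graph_split[OF C(1) X R W]) auto
    show ?thesis unfolding f_def s_eq r1_def r2_def fst_conv snd_conv 1 2 unfolding e by simp
  qed
  have bij: "(\<Sum>s\<in>cuts Y X. f (subgraph X R) (r1 s) * f (subgraph X R') (r2 s)) =
     (\<Sum>p\<in>cuts Y (subgraph X R) \<times> cuts Y (subgraph X R'). f (subgraph X R) (fst p) * f (subgraph X R') (snd p))"
  proof (rule sum.reindex_bij_witness)
    fix s assume s: "s \<in> cuts Y X"
    obtain T \<kappa> where s_eq: "s = (T, \<kappa>)" by fastforce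
    have T: "T \<subseteq> hedges X" and k: "\<kappa> \<in> extensional (cut_boundary X T)"
      using s by (auto simp: cuts_def s_eq nxt_closed_def PiE_def)
    show "(r1 s, r2 s) \<in> cuts Y (subgraph X R) \<times> cuts Y (subgraph X R')"
      using cuts_restrict[OF R, of T \<kappa>] cuts_restrict[OF R', of T \<kappa>] s by (simp add: r1_def r2_def s_eq)
    have "(\<lambda>h. if h \<in> R then restrict \<kappa> R h else restrict \<kappa> R' h) = \<kappa>"
      using k T by (auto simp: fun_eq_iff extensional_def cut_boundary_def R'_def)
    moreover have "T \<inter> R \<union> T \<inter> R' = T" using T by (auto simp: R'_def)
    ultimately show "(\<lambda>(s1, s2). (fst s1 \<union> fst s2, \<lambda>h. if h \<in> R then snd s1 h else snd s2 h)) (r1 s, r2 s) = s"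
      by (simp only: r1_def r2_def s_eq case_prod_conv fst_conv snd_conv)
    show "f (subgraph X R) (fst (r1 s, r2 s)) * f (subgraph X R') (snd (r1 s, r2 s)) =
      f (subgraph X R) (r1 s) * f (subgraph X R') (r2 s)" by simp
  next
    fix p assume p: "p \<in> cuts Y (subgraph X R) \<times> cuts Y (subgraph X R')"
    obtain T1 k1 T2 k2 where p_eq: "p = ((T1, k1), (T2, k2))" by (metis prod.exhaust)
    have s: "(T1, k1) \<in> cuts Y (subgraph X R)" "(T2, k2) \<in> cuts Y (subgraph X R')" using p by (auto simp: p_eq)
    have T: "T1 \<subseteq> R" "T2 \<subseteq> R'" using s by (auto simp: cuts_def nxt_closed_def)
    have k: "k1 \<in> extensional R" "k2 \<in> extensional R'"
      using s T by (auto simp: cuts_def PiE_def extensional_def cut_boundary_def)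
    show "(\<lambda>(s1, s2). (fst s1 \<union> fst s2, \<lambda>h. if h \<in> R then snd s1 h else snd s2 h)) p \<in> cuts Y X"
      using cuts_merge[OF X R s(1) s(2)[unfolded R'_def]]
      by (simp only: p_eq case_prod_conv fst_conv snd_conv)
    have "(T1 \<union> T2) \<inter> R = T1" "(T1 \<union> T2) \<inter> R' = T2" using T by (auto simp: R'_def)
    moreover have "restrict (\<lambda>h. if h \<in> R then k1 h else k2 h) R = k1"
      "restrict (\<lambda>h. if h \<in> R then k1 h else k2 h) R' = k2"
      using k by (auto simp: fun_eq_iff extensional_def R'_def)
    ultimately show "(r1 ((\<lambda>(s1, s2). (fst s1 \<union> fst s2, \<lambda>h. if h \<in> R then snd s1 h else snd s2 h)) p),
        r2 ((\<lambda>(s1, s2). (fst s1 \<union> fst s2, \<lambda>h. if h \<in> R then snd s1 h else snd s2 h)) p)) = p"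
      by (simp only: r1_def r2_def p_eq case_prod_conv fst_conv snd_conv)
  qed
  have "weight F X = (\<Sum>s\<in>cuts Y X. f (subgraph X R) (r1 s) * f (subgraph X R') (r2 s))"
    unfolding F[OF X] by (rule sum.cong[OF refl split])
  also have "\<dots> = (\<Sum>s\<in>cuts Y (subgraph X R). f (subgraph X R) s) * (\<Sum>s\<in>cuts Y (subgraph X R'). f (subgraph X R') s)"
    unfolding bij by (simp add: sum_product sum.cartesian_product case_prod_unfold)
  finally show ?thesis
    using F[OF ut_graph_subgraph[OF X R]] F[OF ut_graph_subgraph[OF X R']] by (simp add: R'_def)
qed

text \<open>The empty graph has exactly one cut, into two empty pieces.\<close>

lemma weight_diff_op_exp_empty:
  assumes Y: "finite Y"
    and B: "ut_primitive B" "ut_strutless B" "B \<in> ut_series_over Y"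
    and C: "ut_primitive C" "ut_strutless C" "C \<in> ut_series_over Y"
    and X: "hedges X = {}"
  shows "weight (ut_diff_op (ut_exp B) (ut_exp C)) X = 1"
proof -
  have gX: "ut_graph X" using X by (simp add: ut_graph_def)
  have cuts: "cuts Y X = {({}, \<lambda>_. undefined)}"
    using X by (auto simp: cuts_def nxt_closed_def cut_boundary_def)
  have one: "weight (ut_exp D) (cut_graph X {} c) = 1" if "ut_primitive D" for D c
    by (subst weight_ut_exp[OF that]) (simp_all add: ut_graph_def component_sets_def)
  show ?thesis
    by (subst weight_ut_diff_op[OF gX Y])
      (use ut_exp_strutless[OF B] ut_exp_strutless[OF C] in \<open>auto simp: cuts X one B(1) C(1)\<close>)
qed

theorem corollary8p1:
  fixes Y :: "'y set" and B C :: "'y ut_series"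
  assumes "finite Y"
    and "B \<in> ut_series_s Y" and "ut_strutless B" and "ut_primitive B"
    and "C \<in> ut_series_s Y" and "ut_strutless C" and "ut_primitive C"
  shows "ut_diff_op (ut_exp B) (ut_exp C) = ut_exp (ut_primitive_part (ut_diff_op (ut_exp B) (ut_exp C)))"
proof (rule exp_primitive_part_eqI)
  have over: "B \<in> ut_series_over Y" "C \<in> ut_series_over Y"
    using assms(2,5) by (auto simp: ut_series_s_def)
  note hyps = assms(1,4,3) over(1) assms(7,6) over(2)
  show "weight (ut_diff_op (ut_exp B) (ut_exp C)) X =
      weight (ut_diff_op (ut_exp B) (ut_exp C)) (subgraph X R) *
      weight (ut_diff_op (ut_exp B) (ut_exp C)) (subgraph X (hedges X - R))"
    if "ut_graph X" "R \<in> closed_sets X" for X :: "(nat, 'y) ut_pregraph" and R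
    by (rule weight_diff_op_exp_split[OF hyps that])
  show "weight (ut_diff_op (ut_exp B) (ut_exp C)) X = 1" if "hedges X = {}" for X :: "(nat, 'y) ut_pregraph"
    by (rule weight_diff_op_exp_empty[OF hyps that])
qed

end
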